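(* Let $n\in\mathbb N$, $f\in\mathcal F^{(n)}(X)$, and let $p(\omega)=\langle\omega^{\otimes n},f\rangle$ for $\omega\in M(X)$. Then for every $\omega\in M(X)$, $$\mathbb E_\omega(p)=\sum_{k=1}^n\langle\omega^{\otimes k},\mathbf S(n,k)f\rangle.$$
   Context: Let $X$ be a locally compact Polish space, $\mathbb F\in\{\mathbb R,\mathbb C\}$, $M(X)$ the set of $\mathbb F$-valued Radon measures on $X$. For $n\ge1$, $\mathcal F^{(n)}(X)$ is the space of bounded measurable symmetric compactly supported functions $X^n\to\mathbb F$, $\mathcal F^{(0)}(X)=\mathbb F$, $\omega^{\otimes0}:=1$. $\langle\mu,f\rangle:=\int f\,d\mu$. A polynomial on $M(X)$ is $p(\omega)=\sum_{k=0}^N\langle\omega^{\otimes k},f^{(k)}\rangle$ with $f^{(k)}\in\mathcal F^{(k)}(X)$. Poisson functional: for $\omega\in M(X)$ and such $p$, choose a relatively compact Borel set $\Lambda\subset X$ such that each $f^{(k)}$ ($k\ge1$) vanishes outside $\Lambda^k$, and set $$\mathbb E_\omega(p):=e^{-\omega(\Lambda)}\sum_{m=0}^\infty\frac1{m!}\int_{\Lambda^m}p(\delta_{x_1}+\dots+\delta_{x_m})\,\omega^{\otimes m}(dx_1\cdots dx_m)$$ (the $m=0$ term being $p(0)$); this value does not depend on the choice of $\Lambda$. For $\omega\in M(X)$, $(\omega)_k(dx_1\cdots dx_k)=\omega(dx_1)(\omega(dx_2)-\delta_{x_1}(dx_2))\cdots(\omega(dx_k)-\delta_{x_1}(dx_k)-\dots-\delta_{x_{k-1}}(dx_k))$.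 For $1\le k\le n$, $\mathbf S(n,k):\mathcal F^{(n)}(X)\to\mathcal F^{(k)}(X)$ are the linear operators uniquely determined by $\langle\omega^{\otimes n},f\rangle=\sum_{k=1}^n\langle(\omega)_k,\mathbf S(n,k)f\rangle$ for all $\omega\in M(X)$, $f\in\mathcal F^{(n)}(X)$. *)

theory Defs
  imports "HOL-Analysis.Analysis"
begin

text \<open>
  The space \<open>X\<close> is a type \<open>'a :: polish_space\<close>, assumed locally compact in the theorem. The scalar
  field is a type \<open>'k :: {real_normed_field, euclidean_space}\<close>. Both \<open>real\<close> and \<open>complex\<close> are
  instances, and up to isometric isomorphism they are the only ones, since a finite-dimensional
  commutative real division algebra with multiplicative norm is either the reals or the complex
  numbers.

  A scalar Radon measure need not extend to all Borel sets (think of a signed measure with infinite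
  positive and negative parts), so it is a set function which is countably additive on the ring of
  relatively compact Borel sets. Regularity is automatic in a locally compact Polish space. Off
  this ring the value is fixed to be 0, so that equal measures are equal functions.
\<close>

definition relcompact_borel :: "'a::polish_space set set" where
  "relcompact_borel = {A \<in> sets borel. compact (closure A)}"

definition radon_measures :: "('a::polish_space set \<Rightarrow> 'k::{real_normed_field, euclidean_space}) set"
  where
  "radon_measures = {\<omega>.
     (\<forall>A. A \<notin> relcompact_borel \<longrightarrow> \<omega> A = 0) \<and>
     (\<forall>A :: nat \<Rightarrow> 'a set. range A \<subseteq> relcompact_borel \<longrightarrow> disjoint_family A \<longrightarrow>
        (\<Union>i. A i) \<in> relcompact_borel \<longrightarrow> (\<lambda>i. \<omega> (A i)) sums \<omega> (\<Union>i. A i))}"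

definition point_config :: "nat \<Rightarrow> (nat \<Rightarrow> 'a::polish_space) \<Rightarrow> 'a set \<Rightarrow> 'k::{real_normed_field, euclidean_space}"
  where
  "point_config m x = (\<lambda>A. if A \<in> relcompact_borel then \<Sum>i<m. indicator A (x i) else 0)"

text \<open>
  A point of \<open>X^k\<close> is an extensional function on \<open>{..<k}\<close>; in particular \<open>X^0\<close> consists of
  \<open>\<lambda>_. undefined\<close> only. As \<open>X\<close> is second countable, the product sigma-algebra is the Borel
  sigma-algebra of the product topology.
\<close>

definition pow_space :: "nat \<Rightarrow> (nat \<Rightarrow> 'a::polish_space) measure" where
  "pow_space k = PiM {..<k} (\<lambda>_. borel)"

definition pow_top :: "nat \<Rightarrow> (nat \<Rightarrow> 'a::polish_space) topology" where
  "pow_top k = product_topology (\<lambda>_. euclidean) {..<k}"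

text \<open>
  Functions on \<open>X^k\<close> are extended by 0 to all of \<open>nat \<Rightarrow> 'a\<close>: the clause on \<open>K\<close> below expresses
  this together with compactness of the support.
\<close>

definition sym_funs :: "nat \<Rightarrow> ((nat \<Rightarrow> 'a::polish_space) \<Rightarrow> 'k::{real_normed_field, euclidean_space}) set"
  where
  "sym_funs k = {f.
     f \<in> borel_measurable (pow_space k) \<and>
     bounded (range f) \<and>
     (\<forall>\<pi>. \<pi> permutes {..<k} \<longrightarrow> (\<forall>x \<in> space (pow_space k). f (x \<circ> \<pi>) = f x)) \<and>
     (\<exists>K. compactin (pow_top k) K \<and> (\<forall>x. x \<notin> K \<longrightarrow> f x = 0))}"

text \<open>
  Integration of bounded measurable compactly supported functions against a scalar measure \<open>\<nu>\<close> on
  \<open>X^k\<close>: the integral is the limit of the integrals of simple functions which converge uniformly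
  and vanish outside a common compact set.
\<close>

definition pow_simple_integral ::
    "nat \<Rightarrow> ((nat \<Rightarrow> 'a::polish_space) set \<Rightarrow> 'k) \<Rightarrow> ((nat \<Rightarrow> 'a) \<Rightarrow> 'k) \<Rightarrow> 'k::{real_normed_field, euclidean_space}"
  where
  "pow_simple_integral k \<nu> s =
     (\<Sum>c \<in> s ` space (pow_space k) - {0}. c * \<nu> (s -` {c} \<inter> space (pow_space k)))"

definition simple_approx ::
    "nat \<Rightarrow> (nat \<Rightarrow> (nat \<Rightarrow> 'a::polish_space) \<Rightarrow> 'k) \<Rightarrow> ((nat \<Rightarrow> 'a) \<Rightarrow> 'k::{real_normed_field, euclidean_space}) \<Rightarrow> bool"
  where
  "simple_approx k s f \<longleftrightarrow>
     (\<forall>i. simple_function (pow_space k) (s i)) \<and>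
     (\<exists>K. compactin (pow_top k) K \<and> (\<forall>i. \<forall>x \<in> space (pow_space k) - K. s i x = 0)) \<and>
     uniform_limit (space (pow_space k)) s f sequentially"

definition pow_integral ::
    "nat \<Rightarrow> ((nat \<Rightarrow> 'a::polish_space) set \<Rightarrow> 'k) \<Rightarrow> ((nat \<Rightarrow> 'a) \<Rightarrow> 'k) \<Rightarrow> 'k::{real_normed_field, euclidean_space}"
  where
  "pow_integral k \<nu> f =
     (THE I. \<forall>s. simple_approx k s f \<longrightarrow> (\<lambda>i. pow_simple_integral k \<nu> (s i)) \<longlonglongrightarrow> I)"

text \<open>
  The product measure is built by integrating the measures of the sections in the last coordinate.
  In the falling factorial, the last factor is
  \<open>\<omega>(dx\<^sub>k) - \<delta>\<^bsub>x\<^sub>0\<^esub>(dx\<^sub>k) - \<dots> - \<delta>\<^bsub>x\<^sub>k\<^sub>-\<^sub>1\<^esub>(dx\<^sub>k)\<close>, with coordinates numbered from 0.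
\<close>

primrec tensor_power ::
    "('a::polish_space set \<Rightarrow> 'k) \<Rightarrow> nat \<Rightarrow> (nat \<Rightarrow> 'a) set \<Rightarrow> 'k::{real_normed_field, euclidean_space}"
  where
  "tensor_power \<omega> 0 = (\<lambda>A. indicator A (\<lambda>_. undefined))"
| "tensor_power \<omega> (Suc k) =
     (\<lambda>A. pow_integral k (tensor_power \<omega> k) (\<lambda>x. \<omega> {y. x(k := y) \<in> A}))"

primrec falling_power ::
    "('a::polish_space set \<Rightarrow> 'k) \<Rightarrow> nat \<Rightarrow> (nat \<Rightarrow> 'a) set \<Rightarrow> 'k::{real_normed_field, euclidean_space}"
  where
  "falling_power \<omega> 0 = (\<lambda>A. indicator A (\<lambda>_. undefined))"
| "falling_power \<omega> (Suc k) =
     (\<lambda>A. pow_integral k (falling_power \<omega> k)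
            (\<lambda>x. \<omega> {y. x(k := y) \<in> A} - (\<Sum>i<k. indicator A (x(k := x i)))))"

definition poly_coeffs ::
    "nat \<Rightarrow> (nat \<Rightarrow> (nat \<Rightarrow> 'a::polish_space) \<Rightarrow> 'k) \<Rightarrow> (('a set \<Rightarrow> 'k) \<Rightarrow> 'k::{real_normed_field, euclidean_space}) \<Rightarrow> bool"
  where
  "poly_coeffs N g p \<longleftrightarrow>
     (\<forall>k\<le>N. g k \<in> sym_funs k) \<and>
     (\<forall>\<omega> \<in> radon_measures. p \<omega> = (\<Sum>k\<le>N. pow_integral k (tensor_power \<omega> k) (g k)))"

definition poisson_window ::
    "(('a::polish_space set \<Rightarrow> 'k) \<Rightarrow> 'k::{real_normed_field, euclidean_space}) \<Rightarrow> 'a set \<Rightarrow> bool"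
  where
  "poisson_window p \<Lambda> \<longleftrightarrow> \<Lambda> \<in> relcompact_borel \<and>
     (\<exists>N g. poly_coeffs N g p \<and> (\<forall>k \<in> {1..N}. \<forall>x. x \<notin> ({..<k} \<rightarrow>\<^sub>E \<Lambda>) \<longrightarrow> g k x = 0))"

definition poisson_on ::
    "'a::polish_space set \<Rightarrow> ('a set \<Rightarrow> 'k) \<Rightarrow> (('a set \<Rightarrow> 'k) \<Rightarrow> 'k) \<Rightarrow> 'k::{real_normed_field, euclidean_space}"
  where
  "poisson_on \<Lambda> \<omega> p =
     exp (- \<omega> \<Lambda>) *
     (\<Sum>m. 1 / fact m *
        pow_integral m (tensor_power \<omega> m)
          (\<lambda>x. indicator ({..<m} \<rightarrow>\<^sub>E \<Lambda>) x * p (point_config m x)))"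

definition poisson_functional ::
    "('a::polish_space set \<Rightarrow> 'k) \<Rightarrow> (('a set \<Rightarrow> 'k) \<Rightarrow> 'k) \<Rightarrow> 'k::{real_normed_field, euclidean_space}"
  where
  "poisson_functional \<omega> p = poisson_on (SOME \<Lambda>. poisson_window p \<Lambda>) \<omega> p"

text \<open>
  The property which determines the Stirling operators \<open>S n 1, \<dots>, S n n\<close> uniquely.
\<close>

definition stirling_operators ::
    "nat \<Rightarrow> (nat \<Rightarrow> nat \<Rightarrow> ((nat \<Rightarrow> 'a::polish_space) \<Rightarrow> 'k) \<Rightarrow> (nat \<Rightarrow> 'a) \<Rightarrow> 'k::{real_normed_field, euclidean_space}) \<Rightarrow> bool"
  where
  "stirling_operators n S \<longleftrightarrow>
     (\<forall>k \<in> {1..n}.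
        (\<forall>f \<in> sym_funs n. S n k f \<in> sym_funs k) \<and>
        (\<forall>f \<in> sym_funs n. \<forall>g \<in> sym_funs n. S n k (\<lambda>x. f x + g x) = (\<lambda>x. S n k f x + S n k g x)) \<and>
        (\<forall>c. \<forall>f \<in> sym_funs n. S n k (\<lambda>x. c * f x) = (\<lambda>x. c * S n k f x))) \<and>
     (\<forall>\<omega> \<in> radon_measures. \<forall>f \<in> sym_funs n.
        pow_integral n (tensor_power \<omega> n) f =
        (\<Sum>k=1..n. pow_integral k (falling_power \<omega> k) (S n k f)))"

end

theory Submission
  imports Defs "HOL-Probability.Infinite_Product_Measure"
begin

text \<open>
  On a relatively compact Borel set \<open>L\<close> a scalar Radon measure is \<open>h dP\<close> with \<open>P\<close> a probability
  measure and \<open>h\<close> integrable, so that \<open>\<omega>\<^sup>\<otimes>\<^sup>k\<close> restricted to \<open>L\<^sup>k\<close> has density \<open>\<Prod>i<k. h (x i)\<close> and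
  integrals against it are Bochner integrals to which Fubini's theorem applies. The \<open>k\<close>-th falling
  power of a point configuration \<open>x 0, \<dots>, x (m - 1)\<close> is the sum of the point masses at the
  \<open>k\<close>-tuples of points with distinct indices. With \<open>g k = S n k f\<close> this gives
  \<open>p (\<delta>\<^bsub>x 0\<^esub> + \<dots>) = (\<Sum>k. \<Sum>\<iota>. g k (x \<circ> \<iota>))\<close>, where \<open>\<iota>\<close> ranges over the injections of \<open>{..<k}\<close>
  into \<open>{..<m}\<close>. Integrating, each of the \<open>m! / (m - k)!\<close> injections contributes
  \<open>\<langle>\<omega>\<^sup>\<otimes>\<^sup>k, g k\<rangle> * \<omega>(L) ^ (m - k)\<close>, and summing over \<open>m\<close> with weights \<open>1 / m!\<close> produces the factor
  \<open>exp (\<omega> L)\<close>. As the window \<open>L\<close> is an arbitrary choice, one also needs that \<open>g k\<close> vanishes outside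
  \<open>L\<^sup>k\<close>: the values of \<open>p\<close> on point configurations ignore points outside \<open>L\<close> and determine the \<open>g k\<close>.
\<close>

section \<open>Densities of vector measures\<close>

definition countably_additive_fun :: "'a measure \<Rightarrow> ('a set \<Rightarrow> 'b::real_normed_vector) \<Rightarrow> bool" where
  "countably_additive_fun M \<nu> \<longleftrightarrow>
     (\<forall>A :: nat \<Rightarrow> 'a set. range A \<subseteq> sets M \<longrightarrow> disjoint_family A \<longrightarrow>
        (\<lambda>i. \<nu> (A i)) sums \<nu> (\<Union>i. A i))"

lemma countably_additive_funD:
  fixes A :: "nat \<Rightarrow> 'a set"
  assumes "countably_additive_fun M \<nu>" "range A \<subseteq> sets M" "disjoint_family A"
  shows "(\<lambda>i. \<nu> (A i)) sums \<nu> (\<Union>i. A i)"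
  using assms unfolding countably_additive_fun_def by blast

text \<open>The empty set is the disjoint union of countably many copies of itself, and a constant
  series of vectors converges only if its terms are 0.\<close>

lemma countably_additive_fun_empty:
  assumes "countably_additive_fun M \<nu>"
  shows "\<nu> {} = 0"
proof -
  have "(\<lambda>i::nat. \<nu> {}) sums \<nu> (\<Union>i::nat. {})"
    by (rule countably_additive_funD[OF assms]) (auto simp: disjoint_family_on_def)
  then show ?thesis
    using sums_summable summable_const_iff by blast
qed

lemma countably_additive_fun_Un:
  assumes \<nu>: "countably_additive_fun M \<nu>" and "A \<in> sets M" "B \<in> sets M" "A \<inter> B = {}"
  shows "\<nu> (A \<union> B) = \<nu> A + \<nu> B"
proof -
  have "(\<lambda>i. \<nu> (binaryset A B i)) sums \<nu> (\<Union>i. binaryset A B i)"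
    using assms
    by (intro countably_additive_funD[OF \<nu>])
       (auto simp: range_binaryset_eq disjoint_family_on_def binaryset_def)
  moreover have "(\<lambda>i. \<nu> (binaryset A B i)) sums (\<nu> A + \<nu> B)"
    by (rule binaryset_sums) (rule countably_additive_fun_empty[OF \<nu>])
  ultimately show ?thesis
    by (simp add: UN_binaryset_eq sums_unique2)
qed

lemma countably_additive_fun_Diff:
  assumes \<nu>: "countably_additive_fun M \<nu>" and "A \<in> sets M" "B \<in> sets M" "B \<subseteq> A"
  shows "\<nu> (A - B) = \<nu> A - \<nu> B"
  using countably_additive_fun_Un[OF \<nu>, of B "A - B"] assms by (auto simp: Un_absorb1)

text \<open>Turns a nonnegative set function into a value of type \<open>measure\<close>, so that
  the Radon-Nikodym theorem becomes applicable. The total mass is finite because \<open>g\<close> is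
  real-valued.\<close>

lemma finite_measure_of_nonneg:
  fixes g :: "'a set \<Rightarrow> real"
  assumes g: "countably_additive_fun M g" and nonneg: "\<And>A. A \<in> sets M \<Longrightarrow> g A \<ge> 0"
  obtains N where "finite_measure N" "sets N = sets M" "\<And>A. A \<in> sets M \<Longrightarrow> emeasure N A = ennreal (g A)"
    "\<And>A. A \<in> sets M \<Longrightarrow> measure N A = g A"
proof -
  define N where "N = measure_of (space M) (sets M) (\<lambda>A. ennreal (g A))"
  have sets_N: "sets N = sets M"
    unfolding N_def by simp
  have em: "emeasure N A = ennreal (g A)" if "A \<in> sets M" for A
  proof (rule emeasure_measure_of[OF N_def])
    show "sets M \<subseteq> Pow (space M)" by (rule sets.space_closed)
    show "A \<in> sets N" using that sets_N by simp
    show "positive (sets N) (\<lambda>A. ennreal (g A))"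
      by (simp add: positive_def countably_additive_fun_empty[OF g])
    show "countably_additive (sets N) (\<lambda>A. ennreal (g A))"
    proof (rule countably_additiveI)
      fix A :: "nat \<Rightarrow> 'a set" assume A: "range A \<subseteq> sets N" "disjoint_family A"
      have s: "(\<lambda>i. g (A i)) sums g (\<Union>i. A i)"
        using countably_additive_funD[OF g] A sets_N by auto
      have nn: "0 \<le> g (A i)" for i
        using A(1) sets_N by (intro nonneg) auto
      show "(\<Sum>i. ennreal (g (A i))) = ennreal (g (\<Union>i. A i))"
        by (rule suminf_ennreal_eq[OF nn s])
    qed
  qed
  have "space N = space M"
    unfolding N_def by simp
  then have "finite_measure N"
    by (intro finite_measureI) (simp add: em)
  moreover have "measure N A = g A" if "A \<in> sets M" for A
    using em[OF that] nonneg[OF that] by (simp add: measure_def)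
  ultimately show ?thesis
    using that sets_N em by blast
qed

section \<open>Positive variation and Jordan decomposition\<close>

definition upper_variation :: "'a measure \<Rightarrow> ('a set \<Rightarrow> real) \<Rightarrow> 'a set \<Rightarrow> ennreal" where
  "upper_variation M \<nu> A = (SUP B\<in>{B \<in> sets M. B \<subseteq> A}. ennreal (\<nu> B))"

lemma upper_variation_upper:
  "B \<in> sets M \<Longrightarrow> B \<subseteq> A \<Longrightarrow> ennreal (\<nu> B) \<le> upper_variation M \<nu> A"
  unfolding upper_variation_def by (rule SUP_upper) auto

lemma upper_variation_mono:
  "A \<subseteq> B \<Longrightarrow> upper_variation M \<nu> A \<le> upper_variation M \<nu> B"
  unfolding upper_variation_def by (rule SUP_subset_mono) auto

text \<open>Subsets of \<open>A\<close> and of \<open>B\<close> are disjoint, hence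
  \<open>\<nu>\<close> adds up on their union; the two suprema are then taken one after the other. A
  negative value is cut off to 0 by \<open>ennreal\<close>, and in that case the other subset alone
  suffices.\<close>

lemma upper_variation_Un_ge:
  assumes \<nu>: "countably_additive_fun M \<nu>" and "A \<in> sets M" "B \<in> sets M" "A \<inter> B = {}"
  shows "upper_variation M \<nu> A + upper_variation M \<nu> B \<le> upper_variation M \<nu> (A \<union> B)"
proof -
  have key: "ennreal (\<nu> A') + ennreal (\<nu> B') \<le> upper_variation M \<nu> (A \<union> B)"
    if "A' \<in> sets M" "A' \<subseteq> A" "B' \<in> sets M" "B' \<subseteq> B" for A' B'
  proof (cases "\<nu> A' \<ge> 0 \<and> \<nu> B' \<ge> 0")
    case True
    have "A' \<inter> B' = {}"
      using that assms(4) by auto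
    then have "ennreal (\<nu> A') + ennreal (\<nu> B') = ennreal (\<nu> (A' \<union> B'))"
      using that True by (simp add: countably_additive_fun_Un[OF \<nu>])
    then show ?thesis
      using that by (auto intro!: upper_variation_upper)
  next
    case False
    then have "ennreal (\<nu> A') = 0 \<or> ennreal (\<nu> B') = 0"
      by (auto simp: ennreal_neg)
    moreover have "ennreal (\<nu> A') \<le> upper_variation M \<nu> (A \<union> B)"
      "ennreal (\<nu> B') \<le> upper_variation M \<nu> (A \<union> B)"
      using that by (auto intro!: upper_variation_upper)
    ultimately show ?thesis
      by auto
  qed
  have ne: "{B' \<in> sets M. B' \<subseteq> C} \<noteq> {}" for C
    by auto
  have "ennreal (\<nu> A') + upper_variation M \<nu> B \<le> upper_variation M \<nu> (A \<union> B)"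
    if "A' \<in> sets M" "A' \<subseteq> A" for A'
    unfolding upper_variation_def[of M \<nu> B] ennreal_SUP_add_right[OF ne]
    using key[OF that] by (intro SUP_least) blast
  then show ?thesis
    unfolding upper_variation_def[of M \<nu> A] ennreal_SUP_add_left[OF ne, symmetric]
    by (intro SUP_least) blast
qed

text \<open>A subset \<open>B\<close> of the union splits into the pieces
  \<open>B \<inter> A i\<close>, and \<open>\<nu> B\<close> is the limit of the partial sums of
  their values.\<close>

lemma upper_variation_UN_le:
  fixes A :: "nat \<Rightarrow> 'a set"
  assumes \<nu>: "countably_additive_fun M \<nu>" and A: "range A \<subseteq> sets M" "disjoint_family A"
  shows "upper_variation M \<nu> (\<Union>i. A i) \<le> (\<Sum>i. upper_variation M \<nu> (A i))"
  unfolding upper_variation_def[of M \<nu> "\<Union>i. A i"]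
proof (rule SUP_least, clarsimp)
  fix B assume B: "B \<in> sets M" "B \<subseteq> (\<Union>i. A i)"
  have "(\<lambda>i. \<nu> (B \<inter> A i)) sums \<nu> (\<Union>i. B \<inter> A i)"
    using A B by (intro countably_additive_funD[OF \<nu>]) (auto simp: disjoint_family_on_def)
  also have "(\<Union>i. B \<inter> A i) = B"
    using B by auto
  finally have "(\<lambda>n. ennreal (\<Sum>i<n. \<nu> (B \<inter> A i))) \<longlonglongrightarrow> ennreal (\<nu> B)"
    unfolding sums_def by (rule tendsto_ennrealI)
  moreover have "ennreal (\<Sum>i<n. \<nu> (B \<inter> A i)) \<le> (\<Sum>i. upper_variation M \<nu> (A i))" for n
  proof -
    \<comment> \<open>\<open>ennreal\<close> is additive only on nonnegative reals, hence the
      passage to positive parts.\<close>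
    have "ennreal (\<Sum>i<n. \<nu> (B \<inter> A i)) \<le> ennreal (\<Sum>i<n. max 0 (\<nu> (B \<inter> A i)))"
      by (intro ennreal_leI sum_mono) simp
    also have "\<dots> = (\<Sum>i<n. ennreal (max 0 (\<nu> (B \<inter> A i))))"
      by (simp add: sum_ennreal)
    also have "\<dots> = (\<Sum>i<n. ennreal (\<nu> (B \<inter> A i)))"
      by (intro sum.cong refl) (simp add: max_def ennreal_neg)
    also have "\<dots> \<le> (\<Sum>i<n. upper_variation M \<nu> (A i))"
      using A B by (intro sum_mono upper_variation_upper) auto
    also have "\<dots> \<le> (\<Sum>i. upper_variation M \<nu> (A i))"
      by (rule sum_le_suminf) auto
    finally show ?thesis .
  qed
  ultimately show "ennreal (\<nu> B) \<le> (\<Sum>i. upper_variation M \<nu> (A i))"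
    by (intro LIMSEQ_le_const2[of _ "ennreal (\<nu> B)"] exI[of _ 0] allI impI)
qed

text \<open>Superadditivity passes to finite unions by induction, and each finite union lies in the
  whole one, so every partial sum of the series is bounded.\<close>

lemma upper_variation_UN_ge:
  fixes A :: "nat \<Rightarrow> 'a set"
  assumes \<nu>: "countably_additive_fun M \<nu>" and A: "range A \<subseteq> sets M" "disjoint_family A"
  shows "(\<Sum>i. upper_variation M \<nu> (A i)) \<le> upper_variation M \<nu> (\<Union>i. A i)"
proof (rule suminf_le_const)
  fix n
  have "(\<Sum>i<n. upper_variation M \<nu> (A i)) \<le> upper_variation M \<nu> (\<Union>i<n. A i)"
  proof (induction n)
    case (Suc n)
    have "(\<Sum>i<Suc n. upper_variation M \<nu> (A i))
        \<le> upper_variation M \<nu> (\<Union>i<n. A i) + upper_variation M \<nu> (A n)"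
      using Suc by (simp add: add_right_mono)
    also have "\<dots> \<le> upper_variation M \<nu> ((\<Union>i<n. A i) \<union> A n)"
    proof (rule upper_variation_Un_ge[OF \<nu>])
      have "A i \<inter> A n = {}" if "i < n" for i
        using that A(2) by (metis disjoint_family_onD UNIV_I less_irrefl)
      then show "(\<Union>i<n. A i) \<inter> A n = {}"
        by auto
    qed (use A(1) in auto)
    finally show ?case
      by (simp add: lessThan_Suc Un_commute)
  qed simp
  also have "\<dots> \<le> upper_variation M \<nu> (\<Union>i. A i)"
    by (rule upper_variation_mono) auto
  finally show "(\<Sum>i<n. upper_variation M \<nu> (A i)) \<le> upper_variation M \<nu> (\<Union>i. A i)" .
qed auto

text \<open>If the variation were infinite, one could split off pieces \<open>E\<close> with \<open>\<bar>\<nu> E\<bar> > 1\<close> for ever,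
  and the values of \<open>\<nu>\<close> on these disjoint pieces would not be summable.\<close>

lemma upper_variation_finite:
  assumes \<nu>: "countably_additive_fun M \<nu>"
  shows "upper_variation M \<nu> (space M) < \<infinity>"
proof (rule ccontr)
  assume inf: "\<not> ?thesis"
  define bad where "bad E \<longleftrightarrow> E \<in> sets M \<and> upper_variation M \<nu> E = \<infinity>" for E
  have step: "\<exists>E'. bad E' \<and> E' \<subseteq> E \<and> \<bar>\<nu> (E - E')\<bar> > 1" if "bad E" for E
  proof -
    have E: "E \<in> sets M" "upper_variation M \<nu> E = \<infinity>"
      using that by (auto simp: bad_def)
    \<comment> \<open>The excess 1 over \<open>\<bar>\<nu> E\<bar>\<close> makes both halves large:
      \<open>\<nu> B > 1\<close> and \<open>\<bar>\<nu> E - \<nu> B\<bar> > 1\<close>. Whichever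
      half retains infinite variation, the discarded one has a value above 1 in modulus.\<close>
    have "ennreal (\<bar>\<nu> E\<bar> + 1) < upper_variation M \<nu> E"
      using E by simp
    then obtain B where B: "B \<in> sets M" "B \<subseteq> E" "ennreal (\<bar>\<nu> E\<bar> + 1) < ennreal (\<nu> B)"
      unfolding upper_variation_def less_SUP_iff by auto
    then have big: "\<nu> B > \<bar>\<nu> E\<bar> + 1"
      using ennreal_less_iff[of "\<bar>\<nu> E\<bar> + 1" "\<nu> B"] by linarith
    have dif: "\<nu> (E - B) = \<nu> E - \<nu> B"
      using E B by (intro countably_additive_fun_Diff[OF \<nu>]) auto
    have "upper_variation M \<nu> (\<Union>i. binaryset B (E - B) i)
        \<le> (\<Sum>i. upper_variation M \<nu> (binaryset B (E - B) i))"
      using E B by (intro upper_variation_UN_le[OF \<nu>])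
        (auto simp: range_binaryset_eq disjoint_family_on_def binaryset_def)
    also have "\<dots> = upper_variation M \<nu> B + upper_variation M \<nu> (E - B)"
      by (rule suminf_binaryset_eq)
         (auto simp: upper_variation_def countably_additive_fun_empty[OF \<nu>] cong: conj_cong)
    also have "(\<Union>i. binaryset B (E - B) i) = E"
      using B by (auto simp: UN_binaryset_eq)
    finally have "upper_variation M \<nu> B = \<infinity> \<or> upper_variation M \<nu> (E - B) = \<infinity>"
      using E by (auto simp: top_unique)
    then show ?thesis
    proof
      assume "upper_variation M \<nu> B = \<infinity>"
      then have "bad B" "B \<subseteq> E" "\<bar>\<nu> (E - B)\<bar> > 1"
        using B big dif by (auto simp: bad_def)
      then show ?thesis by blast
    next
      assume "upper_variation M \<nu> (E - B) = \<infinity>"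
      moreover have "E - (E - B) = B"
        using B by auto
      ultimately have "bad (E - B)" "E - B \<subseteq> E" "\<bar>\<nu> (E - (E - B))\<bar> > 1"
        using E B big by (auto simp: bad_def)
      then show ?thesis by blast
    qed
  qed
  have "bad (space M)"
    using inf less_top[of "upper_variation M \<nu> (space M)"] by (simp add: bad_def del: not_less)
  then have ex: "\<exists>E. bad E"
    by (rule exI)
  have "\<exists>E. \<forall>n. bad (E n) \<and> E (Suc n) \<subseteq> E n \<and> \<bar>\<nu> (E n - E (Suc n))\<bar> > 1"
    by (rule dependent_nat_choice[OF ex step])
  then obtain E where E: "\<And>n. bad (E n)" "\<And>n. E (Suc n) \<subseteq> E n" "\<And>n. \<bar>\<nu> (E n - E (Suc n))\<bar> > 1"
    by (elim exE) blast
  have dec: "E n \<subseteq> E m" if "m \<le> n" for m n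
    by (rule lift_Suc_antimono_le[of E, OF E(2) that])
  define A where "A n = E n - E (Suc n)" for n
  have disj: "A m \<inter> A n = {}" if "m < n" for m n
    using dec[of "Suc m" n] that by (auto simp: A_def)
  have "disjoint_family A"
    unfolding disjoint_family_on_def by (metis disj inf_commute nat_neq_iff)
  moreover have "range A \<subseteq> sets M"
    using E(1) by (auto simp: A_def bad_def)
  ultimately have "(\<lambda>n. \<nu> (A n)) \<longlonglongrightarrow> 0"
    using countably_additive_funD[OF \<nu>] sums_summable summable_LIMSEQ_zero by blast
  then have "\<forall>\<^sub>F n in sequentially. \<bar>\<nu> (A n)\<bar> < 1"
    by (auto simp: tendsto_iff dist_real_def dest: spec[of _ 1])
  then show False
    using E(3) by (auto simp: A_def eventually_sequentially) (metis dual_order.refl less_asym)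
qed

text \<open>The positive variation is countably additive by the two inequalities above, and it is
  finite, so it is a measure \<open>P\<close>. It dominates \<open>\<nu>\<close>, and
  \<open>N\<close> is the nonnegative difference \<open>P - \<nu>\<close>.\<close>

lemma Jordan_decomposition_real:
  fixes \<nu> :: "'a set \<Rightarrow> real"
  assumes \<nu>: "countably_additive_fun M \<nu>"
  obtains P N where "finite_measure P" "finite_measure N" "sets P = sets M" "sets N = sets M"
    "\<And>A. A \<in> sets M \<Longrightarrow> \<nu> A = measure P A - measure N A"
proof -
  define P where "P = measure_of (space M) (sets M) (upper_variation M \<nu>)"
  have sets_P: "sets P = sets M"
    unfolding P_def by simp
  have em: "emeasure P A = upper_variation M \<nu> A" if "A \<in> sets M" for A
  proof (rule emeasure_measure_of[OF P_def])
    show "sets M \<subseteq> Pow (space M)" by (rule sets.space_closed)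
    show "A \<in> sets P" using that sets_P by simp
    show "positive (sets P) (upper_variation M \<nu>)"
      by (auto simp: positive_def upper_variation_def countably_additive_fun_empty[OF \<nu>] cong: conj_cong)
    show "countably_additive (sets P) (upper_variation M \<nu>)"
      using upper_variation_UN_le[OF \<nu>] upper_variation_UN_ge[OF \<nu>] sets_P
      by (intro countably_additiveI antisym) auto
  qed
  have "space P = space M"
    unfolding P_def by simp
  then interpret P: finite_measure P
    using upper_variation_finite[OF \<nu>] by (intro finite_measureI) (auto simp: em)
  have ca: "countably_additive_fun M (\<lambda>A. measure P A - \<nu> A)"
    unfolding countably_additive_fun_def
    using sets_P
    by (auto intro!: sums_diff P.finite_measure_UNION countably_additive_funD[OF \<nu>])
  have nn: "measure P A - \<nu> A \<ge> 0" if "A \<in> sets M" for A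
  proof -
    have "ennreal (\<nu> A) \<le> ennreal (measure P A)"
      using upper_variation_upper[OF that subset_refl, of \<nu>] em[OF that] P.emeasure_eq_measure by auto
    then show ?thesis
      by (simp add: ennreal_le_iff)
  qed
  obtain N where "finite_measure N" "sets N = sets M" "\<And>A. A \<in> sets M \<Longrightarrow> measure N A = measure P A - \<nu> A"
    using finite_measure_of_nonneg[OF ca nn] by metis
  with that[of P N] sets_P P.finite_measure_axioms show ?thesis
    by auto
qed

text \<open>Each coordinate of \<open>\<nu>\<close> has a Jordan decomposition. With respect to a
  suitable probability measure all the measures involved are absolutely continuous; their
  Radon-Nikodym densities give a density for each coordinate, and these recombine to the
  vector-valued \<open>h\<close>.\<close>

lemma vector_measure_density:
  fixes \<nu> :: "'a set \<Rightarrow> 'b::euclidean_space"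
  assumes \<nu>: "countably_additive_fun M \<nu>" and ne: "space M \<noteq> {}"
  obtains P h where "prob_space P" "sets P = sets M" "integrable P h"
    "\<And>A. A \<in> sets M \<Longrightarrow> \<nu> A = (\<integral>x. indicator A x *\<^sub>R h x \<partial>P)"
proof -
  have comp: "countably_additive_fun M (\<lambda>A. \<nu> A \<bullet> b)" for b
    using \<nu> unfolding countably_additive_fun_def
    by (auto intro!: bounded_linear.sums[OF bounded_linear_inner_left])
  have "\<exists>P N. finite_measure P \<and> finite_measure N \<and> sets P = sets M \<and> sets N = sets M \<and>
    (\<forall>A\<in>sets M. \<nu> A \<bullet> b = measure P A - measure N A)" for b
    using Jordan_decomposition_real[OF comp[of b]] by metis
  then obtain P N where P: "\<And>b. finite_measure (P b)" "\<And>b. sets (P b) = sets M"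
    and N: "\<And>b. finite_measure (N b)" "\<And>b. sets (N b) = sets M"
    and PN: "\<And>b A. A \<in> sets M \<Longrightarrow> \<nu> A \<bullet> b = measure (P b) A - measure (N b) A"
    by metis
  obtain x0 where x0: "x0 \<in> space M"
    using ne by auto
  interpret R: prob_space "return M x0"
    using x0 by (rule prob_space_return)
  \<comment> \<open>The point mass at \<open>x0\<close> keeps the total mass positive, so that
    normalising is possible even for \<open>\<nu> = 0\<close>.\<close>
  define g where "g A = measure (return M x0) A + (\<Sum>b\<in>Basis. measure (P b) A + measure (N b) A)" for A
  have "g (space M) \<ge> measure (return M x0) (space M)"
    unfolding g_def by (simp add: sum_nonneg)
  moreover have "measure (return M x0) (space M) = 1"
    using R.prob_space by simp
  ultimately have gpos: "g (space M) > 0"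
    by linarith
  have "countably_additive_fun M (\<lambda>A. g A / g (space M))"
    unfolding countably_additive_fun_def g_def[of "\<Union>_"] g_def[of "_ _"]
    using P N
    by (intro allI impI sums_divide sums_add sums_sum R.finite_measure_UNION
        finite_measure.finite_measure_UNION) auto
  then obtain Q where Q: "finite_measure Q" "sets Q = sets M" "\<And>A. A \<in> sets M \<Longrightarrow> emeasure Q A = ennreal (g A / g (space M))"
    using finite_measure_of_nonneg[of M "\<lambda>A. g A / g (space M)"] gpos
    by (metis (no_types, lifting) divide_nonneg_pos g_def add_nonneg_nonneg measure_nonneg sum_nonneg)
  have spQ: "space Q = space M"
    using Q(2) by (rule sets_eq_imp_space_eq)
  have "prob_space Q"
    using Q(3)[of "space M"] gpos spQ by (intro prob_spaceI) simp
  then interpret Q: prob_space Q .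
  \<comment> \<open>On a null set of \<open>Q\<close> the sum \<open>g\<close> is 0; all its
    summands are nonnegative, so every one of them is 0 there.\<close>
  have null: "measure (P b) A = 0 \<and> measure (N b) A = 0" if "b \<in> Basis" "A \<in> null_sets Q" for b A
  proof -
    have A: "A \<in> sets M" "emeasure Q A = 0"
      using that Q(2) by auto
    then have "g A / g (space M) \<le> 0"
      using Q(3) by (simp add: ennreal_eq_0_iff)
    then have "g A \<le> 0"
      using gpos by (simp add: divide_le_0_iff)
    moreover have "measure (P b) A + measure (N b) A \<le> (\<Sum>b\<in>Basis. measure (P b) A + measure (N b) A)"
      using that by (intro member_le_sum) auto
    ultimately have "measure (P b) A + measure (N b) A \<le> 0"
      unfolding g_def using measure_nonneg[of "return M x0" A] by linarith
    then show ?thesis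
      using measure_nonneg[of "P b" A] measure_nonneg[of "N b" A] by linarith
  qed
  have dens: "\<exists>D. integrable Q D \<and> (\<forall>A\<in>sets M. measure L A = (\<integral>x. indicator A x * D x \<partial>Q))"
    if L: "finite_measure L" "sets L = sets M" "\<And>A. A \<in> null_sets Q \<Longrightarrow> measure L A = 0"
    for L
  proof -
    interpret L: finite_measure L by fact
    have ac: "absolutely_continuous Q L"
      unfolding absolutely_continuous_def
      using L Q(2) by (auto simp: null_sets_def L.emeasure_eq_measure)
    have sLQ: "sets L = sets Q"
      using L Q by simp
    obtain D where D: "D \<in> borel_measurable Q" "AE x in Q. RN_deriv Q L x = ennreal (D x)" "\<And>x. 0 \<le> D x"
      using Q.real_RN_deriv[OF L(1) ac sLQ] by metis
    have *: "emeasure L A = (\<integral>\<^sup>+x. ennreal (indicator A x * D x) \<partial>Q)" if "A \<in> sets M" for A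
    proof -
      have "emeasure L A = emeasure (density Q (RN_deriv Q L)) A"
        using Q.density_RN_deriv[OF ac sLQ] by simp
      also have "\<dots> = (\<integral>\<^sup>+x. RN_deriv Q L x * indicator A x \<partial>Q)"
        using that Q by (intro emeasure_density) auto
      also have "\<dots> = (\<integral>\<^sup>+x. ennreal (indicator A x * D x) \<partial>Q)"
        using D(2) by (intro nn_integral_cong_AE) (auto simp: indicator_def)
      finally show ?thesis .
    qed
    have intD: "integrable Q D"
    proof (rule integrableI_nonneg)
      have "(\<integral>\<^sup>+x. ennreal (D x) \<partial>Q) = (\<integral>\<^sup>+x. ennreal (indicator (space M) x * D x) \<partial>Q)"
        using spQ by (intro nn_integral_cong) (auto simp: indicator_def)
      also have "\<dots> = emeasure L (space M)"
        by (simp add: *)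
      finally show "(\<integral>\<^sup>+x. ennreal (D x) \<partial>Q) < \<infinity>"
        by (simp add: L.emeasure_eq_measure)
    qed (use D in auto)
    have "measure L A = (\<integral>x. indicator A x * D x \<partial>Q)" if "A \<in> sets M" for A
      using D that Q(2) unfolding measure_def *[OF that]
      by (intro integral_eq_nn_integral[symmetric]) auto
    with intD show ?thesis by blast
  qed
  have "\<exists>D. integrable Q D \<and> (\<forall>A\<in>sets M. \<nu> A \<bullet> b = (\<integral>x. indicator A x * D x \<partial>Q))" if b: "b \<in> Basis" for b
  proof -
    obtain D1 where D1: "integrable Q D1" "\<And>A. A\<in>sets M \<Longrightarrow> measure (P b) A = (\<integral>x. indicator A x * D1 x \<partial>Q)"
      using dens[OF P(1)[of b] P(2)] null[OF b] by blast
    obtain D2 where D2: "integrable Q D2" "\<And>A. A\<in>sets M \<Longrightarrow> measure (N b) A = (\<integral>x. indicator A x * D2 x \<partial>Q)"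
      using dens[OF N(1)[of b] N(2)] null[OF b] by blast
    have "\<nu> A \<bullet> b = (\<integral>x. indicator A x * (D1 x - D2 x) \<partial>Q)" if A: "A \<in> sets M" for A
      using D1 D2 A Q(2)
      by (simp add: PN right_diff_distrib Bochner_Integration.integral_diff integrable_real_mult_indicator mult.commute[of "indicator A _"])
    then show ?thesis
      using D1(1) D2(1) by (intro exI[of _ "\<lambda>x. D1 x - D2 x"]) auto
  qed
  then obtain D where D: "\<And>b. b \<in> Basis \<Longrightarrow> integrable Q (D b)"
    "\<And>b A. b \<in> Basis \<Longrightarrow> A \<in> sets M \<Longrightarrow> \<nu> A \<bullet> b = (\<integral>x. indicator A x * D b x \<partial>Q)"
    by metis
  define h where "h x = (\<Sum>b\<in>Basis. D b x *\<^sub>R b)" for x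
  have inth: "integrable Q h"
    unfolding h_def using D by (intro Bochner_Integration.integrable_sum integrable_scaleR_left) auto
  have "\<nu> A = (\<integral>x. indicator A x *\<^sub>R h x \<partial>Q)" if A: "A \<in> sets M" for A
  proof (rule euclidean_eqI)
    fix b :: 'b assume b: "b \<in> Basis"
    have "(\<integral>x. indicator A x *\<^sub>R h x \<partial>Q) \<bullet> b = (\<integral>x. (indicator A x *\<^sub>R h x) \<bullet> b \<partial>Q)"
      using inth A Q(2) by (intro integral_inner_left[symmetric] integrable_mult_indicator) auto
    also have "\<dots> = (\<integral>x. indicator A x * D b x \<partial>Q)"
      using b by (intro Bochner_Integration.integral_cong refl) (simp add: h_def inner_sum_left_Basis)
    finally show "\<nu> A \<bullet> b = (\<integral>x. indicator A x *\<^sub>R h x \<partial>Q) \<bullet> b"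
      using D(2)[OF b A] by simp
  qed
  then show ?thesis
    using that[OF Q.prob_space_axioms Q(2) inth] by blast
qed

section \<open>Tensor powers of Radon measures\<close>

lemma norm_integral_le_integral:
  fixes f :: "'a \<Rightarrow> 'b::{banach, second_countable_topology}"
  assumes "integrable M f" "integrable M g" "\<And>x. x \<in> space M \<Longrightarrow> norm (f x) \<le> g x"
  shows "norm (\<integral>x. f x \<partial>M) \<le> (\<integral>x. g x \<partial>M)"
  by (rule order_trans[OF integral_norm_bound integral_mono]) (use assms in auto)

section \<open>Relatively compact Borel sets and restrictions of Radon measures\<close>

lemma relcompact_borel_subset:
  assumes "L \<in> relcompact_borel" "A \<in> sets borel" "A \<subseteq> L"
  shows "A \<in> relcompact_borel"
  using assms closure_mono[OF assms(3)] closed_Int_compact[of "closure A" "closure L"]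
  by (auto simp: relcompact_borel_def Int_absorb2)

lemma relcompact_borel_Un:
  "A \<in> relcompact_borel \<Longrightarrow> B \<in> relcompact_borel \<Longrightarrow> A \<union> B \<in> relcompact_borel"
  by (auto simp: relcompact_borel_def)

lemma compact_relcompact_borel: "compact K \<Longrightarrow> K \<in> relcompact_borel"
  by (auto simp: relcompact_borel_def compact_imp_closed)

lemma empty_relcompact_borel: "{} \<in> relcompact_borel"
  by (auto simp: relcompact_borel_def)

lemma relcompact_borel_borel: "A \<in> relcompact_borel \<Longrightarrow> A \<in> sets borel"
  by (auto simp: relcompact_borel_def)

text \<open>Every Borel subset of \<open>L\<close> belongs to the ring on which
  \<open>\<omega>\<close> is countably additive. The trace on \<open>L\<close> is therefore defined
  on the full Borel sigma-algebra, and \<open>vector_measure_density\<close> applies to it.\<close>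

lemma radon_measure_restrict:
  assumes "\<omega> \<in> radon_measures" "L \<in> relcompact_borel"
  shows "countably_additive_fun borel (\<lambda>A. \<omega> (A \<inter> L))"
  unfolding countably_additive_fun_def
proof (intro allI impI)
  fix A :: "nat \<Rightarrow> 'a set" assume A: "range A \<subseteq> sets borel" "disjoint_family A"
  have L: "L \<in> sets borel"
    using assms(2) by (rule relcompact_borel_borel)
  have "(\<lambda>i. \<omega> (A i \<inter> L)) sums \<omega> (\<Union>i. A i \<inter> L)"
  proof -
    have "range (\<lambda>i. A i \<inter> L) \<subseteq> relcompact_borel"
      using A L by (auto intro!: relcompact_borel_subset[OF assms(2)])
    moreover have "(\<Union>i. A i \<inter> L) \<in> relcompact_borel"
      using A L by (intro relcompact_borel_subset[OF assms(2)]) auto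
    moreover have "disjoint_family (\<lambda>i. A i \<inter> L)"
      using A(2) by (auto simp: disjoint_family_on_def)
    ultimately show ?thesis
      using assms(1) unfolding radon_measures_def by blast
  qed
  then show "(\<lambda>i. \<omega> (A i \<inter> L)) sums \<omega> (\<Union> (range A) \<inter> L)"
    by (simp add: Int_UN_distrib2)
qed

lemma radon_measure_empty: "\<omega> \<in> radon_measures \<Longrightarrow> \<omega> {} = 0"
  using countably_additive_fun_empty[OF radon_measure_restrict[OF _ empty_relcompact_borel]] by auto

text \<open>A relation rather than a chosen pair: the same \<open>P\<close> and \<open>h\<close> can
  serve for every measure that agrees with \<open>\<omega>\<close> inside \<open>L\<close>. Outside
  \<open>L\<close> only integrability of \<open>h\<close> is demanded.\<close>

definition density_on ::
    "('a::polish_space set \<Rightarrow> 'k::{real_normed_field, euclidean_space}) \<Rightarrow> 'a set \<Rightarrow> 'a measure \<Rightarrow> ('a \<Rightarrow> 'k) \<Rightarrow> bool"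
  where
  "density_on \<omega> L P h \<longleftrightarrow> prob_space P \<and> sets P = sets borel \<and> integrable P h \<and>
     (\<forall>A\<in>sets borel. A \<subseteq> L \<longrightarrow> \<omega> A = (\<integral>x. indicator A x * h x \<partial>P))"

lemma density_on_exists:
  fixes \<omega> :: "'a::polish_space set \<Rightarrow> 'k::{real_normed_field, euclidean_space}"
  assumes "\<omega> \<in> radon_measures" and L: "L \<in> relcompact_borel"
  obtains P h where "density_on \<omega> L P h" "\<And>x. x \<notin> L \<Longrightarrow> h x = 0"
proof -
  obtain P and h :: "'a \<Rightarrow> 'k" where P: "prob_space P" "sets P = sets borel" "integrable P h"
    and eq: "\<And>A. A \<in> sets borel \<Longrightarrow> \<omega> (A \<inter> L) = (\<integral>x. indicator A x *\<^sub>R h x \<partial>P)"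
    using vector_measure_density[OF radon_measure_restrict[OF assms]] by auto
  \<comment> \<open>Cutting \<open>h\<close> off outside \<open>L\<close> keeps it a density on
    \<open>L\<close> and later lets it absorb the indicator of the window.\<close>
  let ?h = "\<lambda>x. indicator L x *\<^sub>R h x"
  have L': "L \<in> sets P"
    using L P by (simp add: relcompact_borel_borel)
  have "density_on \<omega> L P ?h"
    unfolding density_on_def
  proof (intro conjI ballI impI)
    show "integrable P ?h"
      using L' P by (intro integrable_mult_indicator)
  next
    fix A :: "'a set" assume A: "A \<in> sets borel" "A \<subseteq> L"
    then have "\<omega> A = (\<integral>x. indicator A x *\<^sub>R h x \<partial>P)"
      using eq[of A] by (simp add: Int_absorb2)
    also have "\<dots> = (\<integral>x. indicator A x * ?h x \<partial>P)"
      using A by (intro Bochner_Integration.integral_cong refl) (auto simp: indicator_def)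
    finally show "\<omega> A = \<dots>" .
  qed (use P in auto)
  then show ?thesis
    using that[of P ?h] by simp
qed

text \<open>The class for which integrals are computed. It has no symmetry clause because indicators
  and measures of sections are not symmetric, and the support sits in a power of a relatively
  compact set, where \<open>\<omega>\<close> has a density.\<close>

definition supported_bounded ::
    "nat \<Rightarrow> 'a::polish_space set \<Rightarrow> ((nat \<Rightarrow> 'a) \<Rightarrow> 'k::{real_normed_field, euclidean_space}) \<Rightarrow> bool"
  where
  "supported_bounded k L f \<longleftrightarrow> L \<in> relcompact_borel \<and> f \<in> borel_measurable (pow_space k) \<and>
     bounded (f ` space (pow_space k)) \<and> (\<forall>x\<in>space (pow_space k). x \<notin> ({..<k} \<rightarrow>\<^sub>E L) \<longrightarrow> f x = 0)"

section \<open>Measurability and supports in powers of \<open>X\<close>\<close>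

lemma space_pow_space: "space (pow_space k) = {..<k} \<rightarrow>\<^sub>E UNIV"
  by (simp add: pow_space_def space_PiM)

lemma PiE_sets_pow_space: "L \<in> sets borel \<Longrightarrow> ({..<k} \<rightarrow>\<^sub>E L) \<in> sets (pow_space k)"
  unfolding pow_space_def by (intro sets_PiM_I_finite) auto

lemma compactin_closure_power:
  "L \<in> relcompact_borel \<Longrightarrow> compactin (pow_top k) ({..<k} \<rightarrow>\<^sub>E closure L)"
  by (auto simp: pow_top_def compactin_PiE relcompact_borel_def)

text \<open>The union of the coordinate projections of \<open>K\<close> is a finite union of compact
  sets, and its power contains \<open>K\<close>.\<close>

lemma compactin_subset_power:
  fixes K :: "(nat \<Rightarrow> 'a::polish_space) set"
  assumes "compactin (pow_top k) K"
  obtains L where "L \<in> relcompact_borel" "K \<subseteq> {..<k} \<rightarrow>\<^sub>E L"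
proof
  have "compact ((\<lambda>x. x i) ` K)" if "i < k" for i
  proof -
    have "compactin euclidean ((\<lambda>x. x i) ` K)"
      using assms that unfolding pow_top_def
      by (intro image_compactin[OF assms[unfolded pow_top_def]] continuous_map_product_projection) auto
    then show ?thesis by simp
  qed
  then have "compact (\<Union>i<k. (\<lambda>x. x i) ` K)"
    by (intro compact_UN) auto
  then show "(\<Union>i<k. (\<lambda>x. x i) ` K) \<in> relcompact_borel"
    by (rule compact_relcompact_borel)
  have "K \<subseteq> topspace (pow_top k)"
    using assms by (rule compactin_subset_topspace)
  then show "K \<subseteq> {..<k} \<rightarrow>\<^sub>E (\<Union>i<k. (\<lambda>x. x i) ` K)"
    by (auto simp: pow_top_def PiE_iff Ball_def subset_iff)
qed

lemma supported_bounded_sym_funs: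
  assumes "f \<in> sym_funs k"
  obtains L where "supported_bounded k L f" "\<And>x. x \<notin> {..<k} \<rightarrow>\<^sub>E L \<Longrightarrow> f x = 0"
proof -
  obtain K where K: "compactin (pow_top k) K" "\<And>x. x \<notin> K \<Longrightarrow> f x = 0"
    using assms by (auto simp: sym_funs_def)
  obtain L where L: "L \<in> relcompact_borel" "K \<subseteq> {..<k} \<rightarrow>\<^sub>E L"
    using compactin_subset_power[OF K(1)] .
  have "supported_bounded k L f"
    using assms L K by (auto simp: supported_bounded_def sym_funs_def intro: bounded_subset)
  then show ?thesis
    using that L K by blast
qed

text \<open>Rounding each coordinate towards \<open>-\<infinity>\<close> to a multiple of \<open>1 / (i + 1)\<close> fixes 0, so the
  approximating functions inherit the support of \<open>f\<close>.\<close>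

lemma simple_approx_exists:
  fixes f :: "(nat \<Rightarrow> 'a::polish_space) \<Rightarrow> 'k::{real_normed_field, euclidean_space}"
  assumes f: "supported_bounded k L f"
  obtains s where "simple_approx k s f"
    "\<And>i x. x \<in> space (pow_space k) \<Longrightarrow> x \<notin> {..<k} \<rightarrow>\<^sub>E L \<Longrightarrow> s i x = 0"
proof -
  let ?X = "space (pow_space k) :: (nat \<Rightarrow> 'a) set"
  have [measurable]: "f \<in> borel_measurable (pow_space k)"
    using f by (simp add: supported_bounded_def)
  obtain C where C: "\<And>x. x \<in> ?X \<Longrightarrow> norm (f x) \<le> C"
    using f by (auto simp: supported_bounded_def bounded_iff)
  define q where "q i t = real_of_int \<lfloor>t * (real i + 1)\<rfloor> / (real i + 1)" for i and t :: real
  have q_err: "\<bar>q i t - t\<bar> \<le> 1 / (real i + 1)" for i t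
  proof -
    have "q i t - t = (real_of_int \<lfloor>t * (real i + 1)\<rfloor> - t * (real i + 1)) / (real i + 1)"
      by (simp add: q_def field_simps)
    moreover have "\<bar>real_of_int \<lfloor>t * (real i + 1)\<rfloor> - t * (real i + 1)\<bar> \<le> 1"
      by linarith
    ultimately show ?thesis
      by (simp add: abs_divide divide_right_mono)
  qed
  define s where "s i x = (\<Sum>b\<in>Basis. q i (f x \<bullet> b) *\<^sub>R b)" for i x
  have s_zero: "s i x = 0" if "f x = 0" for i x
    using that by (simp add: s_def q_def)
  have [measurable]: "s i \<in> borel_measurable (pow_space k)" for i
    unfolding s_def q_def by measurable
  \<comment> \<open>As \<open>f\<close> is bounded by \<open>C\<close>, each of the finitely many
    coordinates takes only finitely many rounded values.\<close>
  have fin: "finite (s i ` ?X)" for i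
  proof -
    let ?N = "\<lceil>C * (real i + 1)\<rceil> + 1"
    have "s i ` ?X \<subseteq> (\<lambda>g. \<Sum>b\<in>Basis. (real_of_int (g b) / (real i + 1)) *\<^sub>R b) ` ((Basis::'k set) \<rightarrow>\<^sub>E {-?N..?N})"
    proof (intro image_subsetI)
      fix x assume x: "x \<in> ?X"
      let ?g = "\<lambda>b\<in>(Basis::'k set). \<lfloor>(f x \<bullet> b) * (real i + 1)\<rfloor>"
      have "?g b \<in> {-?N..?N}" if b: "b \<in> Basis" for b
      proof -
        have "\<bar>f x \<bullet> b\<bar> \<le> C"
          using Basis_le_norm[OF b, of "f x"] C[OF x] by linarith
        then have "\<bar>(f x \<bullet> b) * (real i + 1)\<bar> \<le> C * (real i + 1)"
          by (simp add: abs_mult mult_right_mono)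
        then show ?thesis
          using b by simp linarith
      qed
      then have "?g \<in> Basis \<rightarrow>\<^sub>E {-?N..?N}"
        by auto
      moreover have "s i x = (\<Sum>b\<in>Basis. (real_of_int (?g b) / (real i + 1)) *\<^sub>R b)"
        unfolding s_def q_def by (intro sum.cong) auto
      ultimately show "s i x \<in> (\<lambda>g. \<Sum>b\<in>Basis. (real_of_int (g b) / (real i + 1)) *\<^sub>R b) ` ((Basis::'k set) \<rightarrow>\<^sub>E {-?N..?N})"
        by blast
    qed
    then show ?thesis
      by (rule finite_subset) (intro finite_imageI finite_PiE finite_Basis finite_atLeastAtMost_int)
  qed
  have simple: "simple_function (pow_space k) (s i)" for i
    by (rule simple_function_borel_measurable) (use fin in auto)
  \<comment> \<open>Each coordinate is off by at most \<open>1 / (i + 1)\<close>, and the norm is at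
    most the sum of the moduli of the \<open>DIM('k)\<close> coordinates.\<close>
  have err: "dist (s i x) (f x) \<le> real DIM('k) / (real i + 1)" for i x
  proof -
    have "dist (s i x) (f x) \<le> (\<Sum>b\<in>Basis. \<bar>(s i x - f x) \<bullet> b\<bar>)"
      unfolding dist_norm by (rule norm_le_l1)
    also have "\<dots> \<le> (\<Sum>b\<in>(Basis::'k set). 1 / (real i + 1))"
      using q_err by (intro sum_mono) (simp add: s_def inner_diff_left)
    finally show ?thesis by simp
  qed
  have "uniform_limit ?X s f sequentially"
  proof (rule uniform_limitI)
    fix e :: real assume "e > 0"
    have "(\<lambda>i. real DIM('k) / (real i + 1)) \<longlonglongrightarrow> 0"
      using LIMSEQ_Suc[OF lim_const_over_n[of "real DIM('k)"]] by (simp add: add.commute)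
    then have "\<forall>\<^sub>F i in sequentially. real DIM('k) / (real i + 1) < e"
      using \<open>e > 0\<close> by (rule order_tendstoD)
    then show "\<forall>\<^sub>F i in sequentially. \<forall>x\<in>?X. dist (s i x) (f x) < e"
      by eventually_elim (use err in \<open>auto intro: le_less_trans\<close>)
  qed
  moreover have supp: "s i x = 0" if "x \<in> ?X" "x \<notin> {..<k} \<rightarrow>\<^sub>E L" for i x
    using that f by (intro s_zero) (auto simp: supported_bounded_def)
  moreover have "\<exists>K. compactin (pow_top k) K \<and> (\<forall>i. \<forall>x \<in> ?X - K. s i x = 0)"
  proof (intro exI conjI allI ballI)
    show "compactin (pow_top k) ({..<k} \<rightarrow>\<^sub>E closure L)"
      using f by (intro compactin_closure_power) (simp add: supported_bounded_def)
    fix i x assume "x \<in> ?X - ({..<k} \<rightarrow>\<^sub>E closure L)"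
    then show "s i x = 0"
      using closure_subset[of L] by (intro supp) (auto simp: PiE_iff)
  qed
  ultimately show ?thesis
    using that[of s] simple unfolding simple_approx_def by blast
qed

text \<open>Some approximating sequence exists, and the limit along it is unique; this is what makes
  the \<open>THE\<close> in \<open>pow_integral\<close> well defined.\<close>

lemma pow_integral_eqI:
  assumes "supported_bounded k L f"
    and "\<And>s. simple_approx k s f \<Longrightarrow> (\<lambda>i. pow_simple_integral k \<nu> (s i)) \<longlonglongrightarrow> I"
  shows "pow_integral k \<nu> f = I"
  unfolding pow_integral_def
proof (rule the_equality)
  obtain s where "simple_approx k s f"
    using simple_approx_exists[OF assms(1)] .
  then show "J = I" if "\<forall>s. simple_approx k s f \<longrightarrow> (\<lambda>i. pow_simple_integral k \<nu> (s i)) \<longlonglongrightarrow> J" for J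
    using assms(2) that LIMSEQ_unique by blast
qed (use assms(2) in blast)

text \<open>The simple functions may live outside the window of \<open>f\<close>. The enlarged
  \<open>L'\<close> contains their common support as well as \<open>L\<close>, so that one density
  on \<open>L'\<close> serves for all of them.\<close>

lemma simple_approx_support:
  assumes "simple_approx k s f" "L \<in> relcompact_borel"
  obtains L' where "L' \<in> relcompact_borel" "L \<subseteq> L'"
    "\<And>i x. x \<in> space (pow_space k) \<Longrightarrow> x \<notin> {..<k} \<rightarrow>\<^sub>E L' \<Longrightarrow> s i x = 0"
proof -
  obtain K where K: "compactin (pow_top k) K" "\<forall>i. \<forall>x \<in> space (pow_space k) - K. s i x = 0"
    using assms(1) unfolding simple_approx_def by blast
  obtain L1 where L1: "L1 \<in> relcompact_borel" "K \<subseteq> {..<k} \<rightarrow>\<^sub>E L1"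
    using compactin_subset_power[OF K(1)] .
  have "({..<k} \<rightarrow>\<^sub>E L1) \<subseteq> ({..<k} \<rightarrow>\<^sub>E L \<union> L1)"
    by (intro PiE_mono) auto
  then show ?thesis
    using that[of "L \<union> L1"] L1 K assms(2) by (auto simp: relcompact_borel_Un subset_iff)
qed

section \<open>Integrals against product densities\<close>

abbreviation pow_prob :: "'a measure \<Rightarrow> nat \<Rightarrow> (nat \<Rightarrow> 'a) measure" where
  "pow_prob P k \<equiv> PiM {..<k} (\<lambda>_. P)"

lemma product_prob_space_const: "prob_space P \<Longrightarrow> product_prob_space (\<lambda>_. P)"
  by (simp add: product_prob_space_def product_prob_space_axioms_def product_sigma_finite_def
      prob_space_imp_sigma_finite)

lemma integrable_bounded_mult:
  fixes f g :: "'b \<Rightarrow> 'k::{real_normed_field, euclidean_space}"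
  assumes "integrable M g" "f \<in> borel_measurable M" "bounded (f ` space M)"
  shows "integrable M (\<lambda>x. f x * g x)"
proof -
  obtain C where C: "\<And>x. x \<in> space M \<Longrightarrow> norm (f x) \<le> C"
    using assms(3) by (auto simp: bounded_iff)
  have "AE x in M. norm (f x * g x) \<le> norm (C *\<^sub>R g x)"
  proof (rule AE_I2)
    fix x assume "x \<in> space M"
    then have "norm (f x) \<le> \<bar>C\<bar>"
      using C[of x] by linarith
    then show "norm (f x * g x) \<le> norm (C *\<^sub>R g x)"
      by (simp add: norm_mult mult_right_mono)
  qed
  moreover have "(\<lambda>x. f x * g x) \<in> borel_measurable M"
    using assms(2) borel_measurable_integrable[OF assms(1)] by (rule borel_measurable_times)
  moreover have "integrable M (\<lambda>x. C *\<^sub>R g x)"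
    using assms(1) by simp
  ultimately show ?thesis
    using Bochner_Integration.integrable_bound by blast
qed

context
  fixes \<omega> :: "'a::polish_space set \<Rightarrow> 'k::{real_normed_field, euclidean_space}" and L P h
  assumes dens: "density_on \<omega> L P h"
begin

lemma sets_pow_prob: "sets (pow_prob P k) = sets (pow_space k)"
  using dens unfolding pow_space_def density_on_def by (intro sets_PiM_cong) auto

lemma space_pow_prob: "space (pow_prob P k) = space (pow_space k)"
  by (rule sets_eq_imp_space_eq[OF sets_pow_prob])

lemma integrable_prod_density: "finite I \<Longrightarrow> integrable (PiM I (\<lambda>_. P)) (\<lambda>x. \<Prod>i\<in>I. h (x i))"
proof -
  interpret product_prob_space "\<lambda>_. P"
    using dens by (intro product_prob_space_const) (simp add: density_on_def)
  assume "finite I"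
  then show ?thesis
    using dens by (intro product_integrable_prod) (auto simp: density_on_def)
qed

lemma integrable_mult_density:
  assumes "f \<in> borel_measurable (pow_space k)" "bounded (f ` space (pow_space k))"
  shows "integrable (pow_prob P k) (\<lambda>x. f x * (\<Prod>i<k. h (x i)))"
  using assms
  by (intro integrable_bounded_mult integrable_prod_density)
     (auto simp: space_pow_prob measurable_cong_sets[OF sets_pow_prob refl])

text \<open>The integrals differ by at most the uniform distance of \<open>s i\<close> and
  \<open>f\<close> times the L1 norm \<open>C\<close> of the product density.\<close>

lemma integral_density_uniform_limit:
  assumes s: "\<And>i. s i \<in> borel_measurable (pow_space k)" "\<And>i. bounded (s i ` space (pow_space k))"
    and f: "f \<in> borel_measurable (pow_space k)" "bounded (f ` space (pow_space k))"
    and lim: "uniform_limit (space (pow_space k)) s f sequentially"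
  shows "(\<lambda>i. \<integral>x. s i x * (\<Prod>i<k. h (x i)) \<partial>pow_prob P k) \<longlonglongrightarrow> (\<integral>x. f x * (\<Prod>i<k. h (x i)) \<partial>pow_prob P k)"
proof (rule tendstoI)
  fix e :: real assume e: "e > 0"
  let ?H = "\<lambda>x. \<Prod>i<k. h (x i)" and ?M = "pow_prob P k"
  \<comment> \<open>\<open>C\<close> may be 0; the tolerance \<open>e / (C + 1)\<close> avoids a
    division by it and leaves the final bound strictly below \<open>e\<close>.\<close>
  define C where "C = (\<integral>x. norm (?H x) \<partial>?M)"
  have C: "C \<ge> 0"
    unfolding C_def by simp
  have "\<forall>\<^sub>F i in sequentially. \<forall>x\<in>space (pow_space k). dist (s i x) (f x) < e / (C + 1)"
    using lim e C by (intro uniform_limitD) auto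
  then show "\<forall>\<^sub>F i in sequentially. dist (\<integral>x. s i x * ?H x \<partial>?M) (\<integral>x. f x * ?H x \<partial>?M) < e"
  proof eventually_elim
    case (elim i)
    have H: "integrable ?M ?H"
      by (rule integrable_prod_density) simp
    have int: "integrable ?M (\<lambda>x. s i x * ?H x)" "integrable ?M (\<lambda>x. f x * ?H x)"
      using s f by (auto intro: integrable_mult_density)
    have "dist (\<integral>x. s i x * ?H x \<partial>?M) (\<integral>x. f x * ?H x \<partial>?M) = norm (\<integral>x. (s i x - f x) * ?H x \<partial>?M)"
      using int by (simp add: dist_norm left_diff_distrib)
    also have "\<dots> \<le> (\<integral>x. e / (C + 1) * norm (?H x) \<partial>?M)"
    proof (rule norm_integral_le_integral)
      show "integrable ?M (\<lambda>x. (s i x - f x) * ?H x)"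
        using int by (simp add: left_diff_distrib)
      show "integrable ?M (\<lambda>x. e / (C + 1) * norm (?H x))"
        using H by simp
      show "norm ((s i x - f x) * ?H x) \<le> e / (C + 1) * norm (?H x)" if "x \<in> space ?M" for x
        using elim that unfolding norm_mult space_pow_prob
        by (intro mult_right_mono) (auto simp: dist_norm less_imp_le)
    qed
    also have "\<dots> = e / (C + 1) * C"
      by (simp add: C_def)
    also have "\<dots> < e"
      using e C by (simp add: field_simps)
    finally show ?case .
  qed
qed

lemma integral_simple_density:
  assumes s: "simple_function (pow_space k) s"
    and \<nu>: "\<And>A. A \<in> sets (pow_space k) \<Longrightarrow> A \<subseteq> ({..<k} \<rightarrow>\<^sub>E L) \<Longrightarrow>
      \<nu> A = (\<integral>x. indicator A x * (\<Prod>i<k. h (x i)) \<partial>pow_prob P k)"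
    and supp: "\<And>x. x \<in> space (pow_space k) \<Longrightarrow> x \<notin> ({..<k} \<rightarrow>\<^sub>E L) \<Longrightarrow> s x = 0"
  shows "pow_simple_integral k \<nu> s = (\<integral>x. s x * (\<Prod>i<k. h (x i)) \<partial>pow_prob P k)"
proof -
  let ?X = "space (pow_space k) :: (nat \<Rightarrow> 'a) set" and ?H = "\<lambda>x. \<Prod>i<k. h (x i)"
  let ?S = "\<lambda>c. s -` {c} \<inter> ?X"
  have fin: "finite (s ` ?X - {0})"
    using simple_functionD(1)[OF s] by simp
  have meas: "?S c \<in> sets (pow_space k)" for c
    using simple_functionD(2)[OF s] .
  \<comment> \<open>The level sets of nonzero values lie in \<open>L\<^sup>k\<close>, where
    \<open>\<nu>\<close> is given by the density.\<close>
  have S: "\<nu> (?S c) = (\<integral>x. indicator (?S c) x * ?H x \<partial>pow_prob P k)" if "c \<noteq> 0" for c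
    using supp that by (intro \<nu> meas) auto
  have bdd: "bounded ((indicator A :: _ \<Rightarrow> 'k) ` Y)" for A Y
    by (rule boundedI[of _ 1]) (auto simp: indicator_def)
  have "pow_simple_integral k \<nu> s = (\<Sum>c\<in>s ` ?X - {0}. \<integral>x. c * (indicator (?S c) x * ?H x) \<partial>pow_prob P k)"
    unfolding pow_simple_integral_def by (intro sum.cong refl) (simp add: S)
  also have "\<dots> = (\<integral>x. (\<Sum>c\<in>s ` ?X - {0}. c * (indicator (?S c) x * ?H x)) \<partial>pow_prob P k)"
    using meas bdd by (intro Bochner_Integration.integral_sum[symmetric] integrable_mult_right integrable_mult_density) auto
  also have "\<dots> = (\<integral>x. s x * ?H x \<partial>pow_prob P k)"
  proof (intro Bochner_Integration.integral_cong refl)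
    fix x assume "x \<in> space (pow_prob P k)"
    then have x: "x \<in> ?X"
      by (simp add: space_pow_prob)
    have "(\<Sum>c\<in>s ` ?X - {0}. c * (indicator (?S c) x * ?H x)) = (\<Sum>c\<in>s ` ?X - {0}. if c = s x then s x * ?H x else 0)"
      using x by (intro sum.cong refl) (auto simp: indicator_def)
    also have "\<dots> = s x * ?H x"
      using x by (simp add: sum.delta[OF fin])
    finally show "(\<Sum>c\<in>s ` ?X - {0}. c * (indicator (?S c) x * ?H x)) = s x * ?H x" .
  qed
  finally show ?thesis .
qed

end

lemma simple_function_bounded: "simple_function M s \<Longrightarrow> bounded (s ` space M)"
  by (simp add: finite_imp_bounded simple_functionD(1))

text \<open>Quantified over every window and every density, since an approximating sequence can
  force the passage to a larger window.\<close>

definition tensor_density ::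
    "('a::polish_space set \<Rightarrow> 'k::{real_normed_field, euclidean_space}) \<Rightarrow> nat \<Rightarrow> bool" where
  "tensor_density \<omega> k \<longleftrightarrow> (\<forall>L P h A. density_on \<omega> L P h \<longrightarrow> L \<in> relcompact_borel \<longrightarrow>
     A \<in> sets (pow_space k) \<longrightarrow> A \<subseteq> ({..<k} \<rightarrow>\<^sub>E L) \<longrightarrow>
     tensor_power \<omega> k A = (\<integral>x. indicator A x * (\<Prod>i<k. h (x i)) \<partial>pow_prob P k))"

text \<open>An approximating sequence \<open>s\<close> is integrated with a density
  \<open>h'\<close> on a larger window \<open>L'\<close>, which gives the limit with
  \<open>h'\<close> in place of \<open>h\<close>. The two integrals of \<open>f\<close> agree
  because a sequence \<open>t\<close> supported in \<open>L\<close> can be integrated with either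
  density.\<close>

lemma pow_integral_tensor_density:
  fixes \<omega> :: "'a::polish_space set \<Rightarrow> 'k::{real_normed_field, euclidean_space}"
  assumes \<omega>: "\<omega> \<in> radon_measures" and td: "tensor_density \<omega> k"
    and f: "supported_bounded k L f" and dens: "density_on \<omega> L P h"
  shows "pow_integral k (tensor_power \<omega> k) f = (\<integral>x. f x * (\<Prod>i<k. h (x i)) \<partial>pow_prob P k)"
proof (rule pow_integral_eqI[OF f])
  have f': "f \<in> borel_measurable (pow_space k)" "bounded (f ` space (pow_space k))" "L \<in> relcompact_borel"
    using f by (auto simp: supported_bounded_def)
  have lim: "(\<lambda>i. \<integral>x. s i x * (\<Prod>i<k. h' (x i)) \<partial>pow_prob P' k) \<longlonglongrightarrow> (\<integral>x. f x * (\<Prod>i<k. h' (x i)) \<partial>pow_prob P' k)"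
    if "simple_approx k s f" "density_on \<omega> L' P' h'" for s L' P' h'
  proof -
    have "simple_function (pow_space k) (s i)" for i
      using that(1) by (simp add: simple_approx_def)
    then show ?thesis
      using f' that
      by (intro integral_density_uniform_limit[OF that(2)])
         (auto simp: simple_approx_def intro: borel_measurable_simple_function simple_function_bounded)
  qed
  fix s assume s: "simple_approx k s f"
  obtain L' where L': "L' \<in> relcompact_borel" "L \<subseteq> L'"
    "\<And>i x. x \<in> space (pow_space k) \<Longrightarrow> x \<notin> {..<k} \<rightarrow>\<^sub>E L' \<Longrightarrow> s i x = 0"
    using simple_approx_support[OF s f'(3)] by blast
  obtain P' h' where dens': "density_on \<omega> L' P' h'"
    using density_on_exists[OF \<omega> L'(1)] by blast
  have eq: "pow_simple_integral k (tensor_power \<omega> k) t = (\<integral>x. t x * (\<Prod>i<k. h'' (x i)) \<partial>pow_prob P'' k)"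
    if "density_on \<omega> L'' P'' h''" "L'' \<in> relcompact_borel" "simple_function (pow_space k) t"
      "\<And>x. x \<in> space (pow_space k) \<Longrightarrow> x \<notin> {..<k} \<rightarrow>\<^sub>E L'' \<Longrightarrow> t x = 0" for t L'' P'' h''
    using td that unfolding tensor_density_def
    by (intro integral_simple_density[OF that(1)]) auto
  obtain t where t: "simple_approx k t f"
    "\<And>i x. x \<in> space (pow_space k) \<Longrightarrow> x \<notin> {..<k} \<rightarrow>\<^sub>E L \<Longrightarrow> t i x = 0"
    using simple_approx_exists[OF f] by blast
  have tL': "t i x = 0" if "x \<in> space (pow_space k)" "x \<notin> {..<k} \<rightarrow>\<^sub>E L'" for i x
    using that L'(2) by (intro t(2)) (auto simp: PiE_iff)
  have "(\<integral>x. t i x * (\<Prod>i<k. h (x i)) \<partial>pow_prob P k) = (\<integral>x. t i x * (\<Prod>i<k. h' (x i)) \<partial>pow_prob P' k)" for i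
    using eq[OF dens f'(3), of "t i"] eq[OF dens' L'(1), of "t i"] t tL' unfolding simple_approx_def by auto
  then have "(\<integral>x. f x * (\<Prod>i<k. h (x i)) \<partial>pow_prob P k) = (\<integral>x. f x * (\<Prod>i<k. h' (x i)) \<partial>pow_prob P' k)"
    using lim[OF t(1) dens] lim[OF t(1) dens'] by (simp add: LIMSEQ_unique)
  moreover have "pow_simple_integral k (tensor_power \<omega> k) (s i) = (\<integral>x. s i x * (\<Prod>i<k. h' (x i)) \<partial>pow_prob P' k)" for i
    using s L'(3) unfolding simple_approx_def by (intro eq[OF dens' L'(1)]) auto
  ultimately show "(\<lambda>i. pow_simple_integral k (tensor_power \<omega> k) (s i)) \<longlonglongrightarrow> (\<integral>x. f x * (\<Prod>i<k. h (x i)) \<partial>pow_prob P k)"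
    using lim[OF s dens'] by simp
qed

section \<open>Sections in the last coordinate\<close>

lemma section_measurable:
  assumes "A \<in> sets (pow_space (Suc k))" "x \<in> space (pow_space k)"
  shows "{y. x(k := y) \<in> A} \<in> sets borel"
proof -
  have "(\<lambda>y. x(k := y)) \<in> measurable borel (pow_space (Suc k))"
    using assms(2) unfolding pow_space_def lessThan_Suc space_PiM
    by (intro measurable_fun_upd[where J="{..<k}"]) (auto simp: space_PiM)
  from measurable_sets[OF this assms(1)] show ?thesis
    by (simp add: vimage_def)
qed

lemma section_subset:
  assumes "A \<subseteq> {..<Suc k} \<rightarrow>\<^sub>E L"
  shows "{y. x(k := y) \<in> A} \<subseteq> L"
proof
  fix y assume "y \<in> {y. x(k := y) \<in> A}"
  then have "x(k := y) \<in> {..<Suc k} \<rightarrow>\<^sub>E L"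
    using assms by blast
  from PiE_mem[OF this, of k] show "y \<in> L"
    by simp
qed

lemma section_support:
  assumes "A \<subseteq> {..<Suc k} \<rightarrow>\<^sub>E L" "x \<in> space (pow_space k)" "x(k := y) \<in> A"
  shows "x \<in> {..<k} \<rightarrow>\<^sub>E L"
proof (rule PiE_I)
  have xA: "x(k := y) \<in> {..<Suc k} \<rightarrow>\<^sub>E L"
    using assms by blast
  show "x i \<in> L" if "i \<in> {..<k}" for i
    using PiE_mem[OF xA, of i] that by simp
  show "x i = undefined" if "i \<notin> {..<k}" for i
    using assms(2) that unfolding space_pow_space by (rule PiE_arb)
qed

text \<open>Induction on \<open>k\<close>: the measure of a section is an integral of
  \<open>h\<close>, so the recursive definition becomes an iterated integral, which Fubini's theorem
  turns into one over \<open>k + 1\<close> coordinates.\<close>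

lemma tensor_density_radon:
  fixes \<omega> :: "'a::polish_space set \<Rightarrow> 'k::{real_normed_field, euclidean_space}"
  assumes \<omega>: "\<omega> \<in> radon_measures"
  shows "tensor_density \<omega> k"
proof (induction k)
  case 0
  show ?case
    unfolding tensor_density_def
  proof (intro allI impI)
    fix L P and h :: "'a \<Rightarrow> 'k" and A :: "(nat \<Rightarrow> 'a) set"
    assume "density_on \<omega> L P h"
    then interpret product_prob_space "\<lambda>_. P"
      by (intro product_prob_space_const) (simp add: density_on_def)
    \<comment> \<open>The empty product measure is counting measure on the single point
      \<open>\<lambda>_. undefined\<close>.\<close>
    show "tensor_power \<omega> 0 A = (\<integral>x. indicator A x * (\<Prod>i<0. h (x i)) \<partial>pow_prob P 0)"
      by (simp add: PiM_empty lebesgue_integral_count_space_finite)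
  qed
next
  case (Suc k)
  show ?case
    unfolding tensor_density_def
  proof (intro allI impI)
    fix L P and h :: "'a \<Rightarrow> 'k" and A :: "(nat \<Rightarrow> 'a) set"
    assume dens: "density_on \<omega> L P h" and L: "L \<in> relcompact_borel"
      and A: "A \<in> sets (pow_space (Suc k))" "A \<subseteq> {..<Suc k} \<rightarrow>\<^sub>E L"
    interpret product_prob_space "\<lambda>_. P"
      using dens by (intro product_prob_space_const) (simp add: density_on_def)
    interpret P: prob_space P
      using dens by (simp add: density_on_def)
    have h: "integrable P h" and sets_P: "sets P = sets borel"
      using dens by (auto simp: density_on_def)
    note [measurable] = borel_measurable_integrable[OF h]
    let ?F = "\<lambda>x. \<omega> {y. x(k := y) \<in> A}"
    have F: "?F x = (\<integral>y. indicator A (x(k := y)) * h y \<partial>P)" if "x \<in> space (pow_space k)" for x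
    proof -
      have "?F x = (\<integral>y. indicator {y. x(k := y) \<in> A} y * h y \<partial>P)"
        using dens section_measurable[OF A(1) that] section_subset[OF A(2)]
        by (auto simp: density_on_def)
      then show ?thesis
        by (simp add: indicator_def)
    qed
    have A': "A \<in> sets (PiM (insert k {..<k}) (\<lambda>_. P))"
      using A(1) sets_pow_prob[OF dens, of "Suc k"] by (simp add: lessThan_Suc)
    have meas: "(\<lambda>x. \<integral>y. indicator A (x(k := y)) * h y \<partial>P) \<in> borel_measurable (pow_prob P k)"
    proof -
      have [measurable]: "indicator A \<in> borel_measurable (PiM (insert k {..<k}) (\<lambda>_. P))"
        using A' by (rule borel_measurable_indicator)
      have [measurable]: "(\<lambda>p. (fst p)(k := snd p)) \<in> measurable (pow_prob P k \<Otimes>\<^sub>M P) (PiM (insert k {..<k}) (\<lambda>_. P))"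
        by (rule measurable_fun_upd[where J="{..<k}"]) auto
      show ?thesis
        by measurable
    qed
    have sb: "supported_bounded k L ?F"
      unfolding supported_bounded_def
    proof (intro conjI ballI impI)
      have "(\<lambda>x. \<integral>y. indicator A (x(k := y)) * h y \<partial>P) \<in> borel_measurable (pow_space k)"
        using meas by (simp add: measurable_cong_sets[OF sets_pow_prob[OF dens] refl])
      then show "?F \<in> borel_measurable (pow_space k)"
        using F by (subst measurable_cong) auto
      \<comment> \<open>The L1 norm of \<open>h\<close> bounds the measures of all sections at
        once.\<close>
      have "norm (?F x) \<le> (\<integral>y. norm (h y) \<partial>P)" if "x \<in> space (pow_space k)" for x
        unfolding F[OF that]
      proof (rule norm_integral_le_integral)
        have "(\<lambda>y. indicator {y. x(k := y) \<in> A} y *\<^sub>R h y) = (\<lambda>y. indicator A (x(k := y)) * h y)"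
          by (auto simp: indicator_def)
        then show "integrable P (\<lambda>y. indicator A (x(k := y)) * h y)"
          using integrable_mult_indicator[of "{y. x(k := y) \<in> A}" P h] h sets_P section_measurable[OF A(1) that]
          by simp
      qed (use h in \<open>auto simp: indicator_def\<close>)
      then show "bounded (?F ` space (pow_space k))"
        unfolding bounded_iff by blast
      fix x assume "x \<in> space (pow_space k)" "x \<notin> {..<k} \<rightarrow>\<^sub>E L"
      then have "{y. x(k := y) \<in> A} = {}"
        using section_support[OF A(2)] by blast
      then show "?F x = 0"
        by (simp add: radon_measure_empty[OF \<omega>])
    qed (rule L)
    have bdd: "bounded ((indicator A :: _ \<Rightarrow> 'k) ` Y)" for Y
      by (rule boundedI[of _ 1]) (auto simp: indicator_def)
    have int: "integrable (pow_prob P (Suc k)) (\<lambda>x. indicator A x * (\<Prod>i<Suc k. h (x i)))"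
      using A(1) bdd by (intro integrable_mult_density[OF dens]) auto
    have "tensor_power \<omega> (Suc k) A = (\<integral>x. ?F x * (\<Prod>i<k. h (x i)) \<partial>pow_prob P k)"
      using pow_integral_tensor_density[OF \<omega> Suc sb dens] by simp
    also have "\<dots> = (\<integral>x. (\<integral>y. indicator A (x(k := y)) * (\<Prod>i<Suc k. h ((x(k := y)) i)) \<partial>P) \<partial>pow_prob P k)"
    proof (intro Bochner_Integration.integral_cong refl)
      fix x assume "x \<in> space (pow_prob P k)"
      then have "x \<in> space (pow_space k)"
        by (simp add: space_pow_prob[OF dens])
      then have "?F x * (\<Prod>i<k. h (x i)) = (\<integral>y. indicator A (x(k := y)) * h y * (\<Prod>i<k. h (x i)) \<partial>P)"
        by (simp add: F)
      also have "\<dots> = (\<integral>y. indicator A (x(k := y)) * (\<Prod>i<Suc k. h ((x(k := y)) i)) \<partial>P)"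
        by (intro Bochner_Integration.integral_cong refl) (simp add: mult_ac)
      finally show "?F x * (\<Prod>i<k. h (x i)) = \<dots>" .
    qed
    also have "\<dots> = (\<integral>x. indicator A x * (\<Prod>i<Suc k. h (x i)) \<partial>pow_prob P (Suc k))"
      unfolding lessThan_Suc[of k]
      by (rule product_integral_insert[symmetric]) (use int in \<open>auto simp: lessThan_Suc\<close>)
    finally show "tensor_power \<omega> (Suc k) A = \<dots>" .
  qed
qed

lemma pow_integral_tensor:
  fixes \<omega> :: "'a::polish_space set \<Rightarrow> 'k::{real_normed_field, euclidean_space}"
  assumes "\<omega> \<in> radon_measures" "supported_bounded k L f" "density_on \<omega> L P h"
  shows "pow_integral k (tensor_power \<omega> k) f = (\<integral>x. f x * (\<Prod>i<k. h (x i)) \<partial>pow_prob P k)"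
  using assms(1) tensor_density_radon[OF assms(1)] assms(2,3) by (rule pow_integral_tensor_density)

section \<open>Falling powers of point configurations\<close>

text \<open>Extensionality makes each injection a single function, so that the set is finite and its
  cardinality is a falling factorial of \<open>m\<close>.\<close>

definition injections :: "nat \<Rightarrow> nat \<Rightarrow> (nat \<Rightarrow> nat) set" where
  "injections k m = {\<iota> \<in> {..<k} \<rightarrow>\<^sub>E {..<m}. inj_on \<iota> {..<k}}"

text \<open>The restriction makes the composition a point of the \<open>k\<close>-th power of
  \<open>X\<close>, whose elements are extensional.\<close>

definition select :: "nat \<Rightarrow> (nat \<Rightarrow> 'a) \<Rightarrow> (nat \<Rightarrow> nat) \<Rightarrow> nat \<Rightarrow> 'a" where
  "select k x \<iota> = (\<lambda>i\<in>{..<k}. x (\<iota> i))"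

lemma finite_injections: "finite (injections k m)"
  unfolding injections_def by (rule finite_subset[of _ "{..<k} \<rightarrow>\<^sub>E {..<m}"]) (auto intro: finite_PiE)

lemma injections_less: "\<iota> \<in> injections k m \<Longrightarrow> i < k \<Longrightarrow> \<iota> i < m"
  by (auto simp: injections_def)

lemma injections_inj: "\<iota> \<in> injections k m \<Longrightarrow> inj_on \<iota> {..<k}"
  by (auto simp: injections_def)

lemma injections_0: "injections 0 m = {\<lambda>_. undefined}"
  by (auto simp: injections_def)

lemma injections_empty:
  assumes "m < k"
  shows "injections k m = {}"
proof -
  have False if "\<iota> \<in> injections k m" for \<iota>
  proof -
    have "card (\<iota> ` {..<k}) \<le> card {..<m}"
      using injections_less[OF that] by (intro card_mono) auto
    then show False
      using card_image[OF injections_inj[OF that]] assms by simp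
  qed
  then show ?thesis by blast
qed

lemma injections_mono: "m \<le> m' \<Longrightarrow> injections k m \<subseteq> injections k m'"
  unfolding injections_def using PiE_mono[of "{..<k}" "\<lambda>_. {..<m}" "\<lambda>_. {..<m'}"] by auto

text \<open>An injection on \<open>k + 1\<close> indices is an injection \<open>\<iota>\<close> on
  the first \<open>k\<close> together with a last value \<open>j\<close> outside its image; the
  inverse map restricts and reads off the value at \<open>k\<close>.\<close>

lemma sum_injections_Suc:
  "(\<Sum>\<iota>\<in>injections (Suc k) m. F \<iota>) = (\<Sum>\<iota>\<in>injections k m. \<Sum>j\<in>{..<m} - \<iota> ` {..<k}. F (\<iota>(k := j)))"
proof -
  let ?S = "Sigma (injections k m) (\<lambda>\<iota>. {..<m} - \<iota> ` {..<k})"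
  have "bij_betw (\<lambda>(\<iota>, j). \<iota>(k := j)) ?S (injections (Suc k) m)"
  proof (rule bij_betw_byWitness[where f' = "\<lambda>\<iota>. (restrict \<iota> {..<k}, \<iota> k)"])
    have "restrict (\<iota>(k := j)) {..<k} = \<iota>" if "\<iota> \<in> injections k m" for \<iota> j
      using that by (intro ext) (auto simp: injections_def restrict_def PiE_def extensional_def)
    then show "\<forall>p\<in>?S. (restrict ((\<lambda>(\<iota>, j). \<iota>(k := j)) p) {..<k}, (\<lambda>(\<iota>, j). \<iota>(k := j)) p k) = p"
      by auto
    have "(restrict \<iota> {..<k})(k := \<iota> k) = \<iota>" if "\<iota> \<in> injections (Suc k) m" for \<iota>
      using that by (intro ext) (auto simp: injections_def restrict_def PiE_def extensional_def less_Suc_eq)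
    then show "\<forall>\<iota>\<in>injections (Suc k) m. (\<lambda>(\<iota>, j). \<iota>(k := j)) (restrict \<iota> {..<k}, \<iota> k) = \<iota>"
      by auto
    have "\<iota>(k := j) \<in> injections (Suc k) m" if "\<iota> \<in> injections k m" "j < m" "j \<notin> \<iota> ` {..<k}" for \<iota> j
    proof -
      have "\<iota>(k := j) \<in> {..<Suc k} \<rightarrow>\<^sub>E {..<m}"
        using that by (auto simp: injections_def PiE_iff extensional_def less_Suc_eq)
      moreover have "inj_on (\<iota>(k := j)) {..<Suc k}"
        unfolding lessThan_Suc inj_on_insert using that
        by (auto simp: injections_def inj_on_def)
      ultimately show ?thesis by (simp add: injections_def)
    qed
    then show "(\<lambda>(\<iota>, j). \<iota>(k := j)) ` ?S \<subseteq> injections (Suc k) m"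
      by auto
    have "restrict \<iota> {..<k} \<in> injections k m \<and> \<iota> k < m \<and> \<iota> k \<notin> restrict \<iota> {..<k} ` {..<k}"
      if "\<iota> \<in> injections (Suc k) m" for \<iota>
    proof -
      have "\<iota> k \<noteq> \<iota> i" if "i < k" for i
        using inj_onD[OF injections_inj[OF \<open>\<iota> \<in> injections (Suc k) m\<close>], of k i] that by auto
      moreover have "inj_on \<iota> {..<k}"
        by (rule inj_on_subset[OF injections_inj[OF that]]) auto
      ultimately show ?thesis
        using injections_less[OF that] by (auto simp: injections_def)
    qed
    then show "(\<lambda>\<iota>. (restrict \<iota> {..<k}, \<iota> k)) ` injections (Suc k) m \<subseteq> ?S"
      by (intro image_subsetI) simp
  qed
  then have "(\<Sum>\<iota>\<in>injections (Suc k) m. F \<iota>) = (\<Sum>p\<in>?S. F ((\<lambda>(\<iota>, j). \<iota>(k := j)) p))"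
    by (rule sum.reindex_bij_betw[symmetric])
  also have "\<dots> = (\<Sum>\<iota>\<in>injections k m. \<Sum>j\<in>{..<m} - \<iota> ` {..<k}. F (\<iota>(k := j)))"
    by (subst sum.Sigma) (auto simp: finite_injections case_prod_beta)
  finally show ?thesis .
qed

text \<open>Each injection on \<open>k\<close> indices has \<open>m - k\<close> extensions by one
  more index. The product form avoids the division in \<open>m! / (m - k)!\<close>.\<close>

lemma card_injections: "k \<le> m \<Longrightarrow> card (injections k m) * fact (m - k) = fact m"
proof (induction k)
  case 0
  then show ?case by (simp add: injections_0)
next
  case (Suc k)
  have "card ({..<m} - \<iota> ` {..<k}) = m - k" if "\<iota> \<in> injections k m" for \<iota>
    using injections_less[OF that] card_image[OF injections_inj[OF that]]
    by (subst card_Diff_subset) auto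
  then have "card (injections (Suc k) m) = card (injections k m) * (m - k)"
    using sum_injections_Suc[of "\<lambda>_. 1::nat" k m] by simp
  moreover have "fact (m - k) = (m - k) * fact (m - Suc k)"
    using Suc.prems fact_reduce[of "m - k", where 'a = nat] by simp
  ultimately show ?case
    using Suc by (simp add: mult.assoc)
qed

section \<open>Point configurations and the tuples selected from them\<close>

lemma select_space: "select k x \<iota> \<in> space (pow_space k)"
  by (simp add: select_def space_pow_space)

lemma select_upd: "(select k x \<iota>)(k := x j) = select (Suc k) x (\<iota>(k := j))"
  by (auto simp: select_def fun_eq_iff restrict_def less_Suc_eq)

lemma measurable_select:
  "\<iota> \<in> injections k m \<Longrightarrow> (\<lambda>x. select k x \<iota>) \<in> measurable (pow_space m) (pow_space k)"
  unfolding select_def pow_space_def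
  by (intro measurable_restrict measurable_component_singleton) (simp add: injections_less)

text \<open>Allows identities that hold for all Radon measures to be evaluated at configurations. At
  most one of the disjoint sets contains a given point, so the series of each point mass has at most
  one nonzero term.\<close>

lemma point_config_radon: "point_config m x \<in> radon_measures"
  unfolding radon_measures_def
proof (intro CollectI conjI allI impI)
  fix A :: "nat \<Rightarrow> 'a set"
  assume A: "range A \<subseteq> relcompact_borel" "disjoint_family A" "(\<Union>i. A i) \<in> relcompact_borel"
  have ind: "(\<lambda>i. indicator (A i) z) sums (indicator (\<Union>i. A i) z :: 'b)" for z
  proof (cases "z \<in> (\<Union>i. A i)")
    case True
    then obtain i0 where i0: "z \<in> A i0" by blast
    have "z \<in> A i \<longleftrightarrow> i = i0" for i
      using disjoint_family_onD[OF A(2), of i i0] i0 by auto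
    then have "(\<lambda>i. indicator (A i) z) = (\<lambda>i. if i = i0 then 1 else 0 :: 'b)"
      by (simp add: indicator_def fun_eq_iff)
    then show ?thesis
      using True sums_single[of i0 "\<lambda>_. 1 :: 'b"] by simp
  qed (auto simp: indicator_def)
  have "point_config m x (A i) = (\<Sum>j<m. indicator (A i) (x j) :: 'b)" for i
    using A(1) by (auto simp: point_config_def)
  moreover have "point_config m x (\<Union>i. A i) = (\<Sum>j<m. indicator (\<Union>i. A i) (x j) :: 'b)"
    using A(3) by (simp add: point_config_def)
  ultimately show "(\<lambda>i. point_config m x (A i)) sums (point_config m x (\<Union>i. A i) :: 'b)"
    using ind by (simp only:) (intro sums_sum)
qed (simp add: point_config_def)

text \<open>The \<open>itself\<close> argument fixes the scalar field, which the other arguments do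
  not determine.\<close>

definition falling_config ::
    "'k::{real_normed_field, euclidean_space} itself \<Rightarrow> nat \<Rightarrow> (nat \<Rightarrow> 'a::polish_space) \<Rightarrow> nat \<Rightarrow> bool" where
  "falling_config _ m x k \<longleftrightarrow> (\<forall>L A. L \<in> relcompact_borel \<longrightarrow> A \<in> sets (pow_space k) \<longrightarrow>
     A \<subseteq> ({..<k} \<rightarrow>\<^sub>E L) \<longrightarrow>
     falling_power (point_config m x) k A = (\<Sum>\<iota>\<in>injections k m. indicator A (select k x \<iota>) :: 'k))"

text \<open>Against a finite sum of point masses a simple function integrates to the sum of its
  values at these points, and uniform convergence gives convergence at each of them.\<close>

lemma pow_integral_falling_config:
  fixes f :: "(nat \<Rightarrow> 'a::polish_space) \<Rightarrow> 'k::{real_normed_field, euclidean_space}"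
  assumes fc: "falling_config TYPE('k) m x k" and f: "supported_bounded k L f"
  shows "pow_integral k (falling_power (point_config m x) k) f = (\<Sum>\<iota>\<in>injections k m. f (select k x \<iota>))"
proof (rule pow_integral_eqI[OF f])
  fix s assume s: "simple_approx k s f"
  let ?X = "space (pow_space k) :: (nat \<Rightarrow> 'a) set"
  obtain L' where L': "L' \<in> relcompact_borel" "{} \<subseteq> L'"
    "\<And>i x. x \<in> ?X \<Longrightarrow> x \<notin> {..<k} \<rightarrow>\<^sub>E L' \<Longrightarrow> s i x = 0"
    by (rule simple_approx_support[OF s empty_relcompact_borel]) (rule that)
  have "pow_simple_integral k (falling_power (point_config m x) k) (s i) = (\<Sum>\<iota>\<in>injections k m. s i (select k x \<iota>))" for i
  proof -
    let ?S = "\<lambda>c. s i -` {c} \<inter> ?X"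
    have simple: "simple_function (pow_space k) (s i)"
      using s by (simp add: simple_approx_def)
    have fin: "finite (s i ` ?X - {0})"
      using simple_functionD(1)[OF simple] by simp
    have "falling_power (point_config m x) k (?S c) = (\<Sum>\<iota>\<in>injections k m. indicator (?S c) (select k x \<iota>) :: 'k)"
      if "c \<noteq> 0" for c
    proof -
      have "?S c \<in> sets (pow_space k)" "?S c \<subseteq> ({..<k} \<rightarrow>\<^sub>E L')"
        using simple_functionD(2)[OF simple] L'(3) that by auto
      then show ?thesis
        using fc L'(1) unfolding falling_config_def by blast
    qed
    then have "pow_simple_integral k (falling_power (point_config m x) k) (s i)
        = (\<Sum>c\<in>s i ` ?X - {0}. \<Sum>\<iota>\<in>injections k m. c * indicator (?S c) (select k x \<iota>))"
      unfolding pow_simple_integral_def by (intro sum.cong refl) (simp add: sum_distrib_left)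
    also have "\<dots> = (\<Sum>\<iota>\<in>injections k m. \<Sum>c\<in>s i ` ?X - {0}. c * indicator (?S c) (select k x \<iota>))"
      by (rule sum.swap)
    also have "\<dots> = (\<Sum>\<iota>\<in>injections k m. s i (select k x \<iota>))"
    proof (intro sum.cong refl)
      fix \<iota>
      have "(\<Sum>c\<in>s i ` ?X - {0}. c * indicator (?S c) (select k x \<iota>))
          = (\<Sum>c\<in>s i ` ?X - {0}. if c = s i (select k x \<iota>) then s i (select k x \<iota>) else 0)"
        using select_space[of k x \<iota>] by (intro sum.cong refl) (auto simp: indicator_def)
      also have "\<dots> = s i (select k x \<iota>)"
        using select_space[of k x \<iota>] by (auto simp: sum.delta[OF fin])
      finally show "(\<Sum>c\<in>s i ` ?X - {0}. c * indicator (?S c) (select k x \<iota>)) = s i (select k x \<iota>)" .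
    qed
    finally show ?thesis .
  qed
  moreover have "(\<lambda>i. s i (select k x \<iota>)) \<longlonglongrightarrow> f (select k x \<iota>)" for \<iota>
    using s by (intro tendsto_uniform_limitI[OF _ select_space]) (simp add: simple_approx_def)
  ultimately show "(\<lambda>i. pow_simple_integral k (falling_power (point_config m x) k) (s i))
      \<longlonglongrightarrow> (\<Sum>\<iota>\<in>injections k m. f (select k x \<iota>))"
    by (simp add: tendsto_sum)
qed

lemma measurable_upd:
  assumes "g \<in> borel_measurable (pow_space k)"
  shows "(\<lambda>x. x(k := g x)) \<in> measurable (pow_space k) (pow_space (Suc k))"
  using assms unfolding pow_space_def lessThan_Suc
  by (intro measurable_fun_upd[where J="{..<k}"]) auto

text \<open>Induction on \<open>k\<close>. At the tuple selected by \<open>\<iota>\<close> the last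
  factor is the sum of the masses at all \<open>x j\<close> minus those at the
  \<open>x (\<iota> i)\<close>, which leaves the indices \<open>j\<close> outside the image of
  \<open>\<iota>\<close>. Indices and not positions are kept distinct, so coinciding points count
  with multiplicity.\<close>

lemma falling_config:
  fixes x :: "nat \<Rightarrow> 'a::polish_space"
  shows "falling_config TYPE('k::{real_normed_field, euclidean_space}) m x k"
proof (induction k)
  case 0
  show ?case
    by (auto simp: falling_config_def injections_0 select_def)
next
  case (Suc k)
  show ?case
    unfolding falling_config_def
  proof (intro allI impI)
    fix L and A :: "(nat \<Rightarrow> 'a) set"
    assume L: "L \<in> relcompact_borel" and A: "A \<in> sets (pow_space (Suc k))" "A \<subseteq> {..<Suc k} \<rightarrow>\<^sub>E L"
    let ?I = "indicator A :: _ \<Rightarrow> 'k"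
    let ?F = "\<lambda>y. point_config m x {z. y(k := z) \<in> A} - (\<Sum>i<k. ?I (y(k := y i)))"
    have F: "?F y = (\<Sum>j<m. ?I (y(k := x j))) - (\<Sum>i<k. ?I (y(k := y i)))" if "y \<in> space (pow_space k)" for y
    proof -
      have "{z. y(k := z) \<in> A} \<in> relcompact_borel"
        using section_measurable[OF A(1) that] section_subset[OF A(2)]
        by (rule relcompact_borel_subset[OF L])
      then show ?thesis
        by (simp add: point_config_def indicator_def)
    qed
    have sb: "supported_bounded k L ?F"
      unfolding supported_bounded_def
    proof (intro conjI ballI impI)
      have I: "?I \<in> borel_measurable (pow_space (Suc k))"
        using A(1) by (rule borel_measurable_indicator)
      have "(\<lambda>y. ?I (y(k := g y))) \<in> borel_measurable (pow_space k)" if "g \<in> borel_measurable (pow_space k)" for g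
        using measurable_compose[OF measurable_upd[OF that] I] .
      moreover have "(\<lambda>y. y i) \<in> borel_measurable (pow_space k)" if "i < k" for i
        using that unfolding pow_space_def by (intro measurable_component_singleton) simp
      ultimately have "(\<lambda>y. (\<Sum>j<m. ?I (y(k := x j))) - (\<Sum>i<k. ?I (y(k := y i)))) \<in> borel_measurable (pow_space k)"
        by (intro borel_measurable_diff borel_measurable_sum) auto
      then show "?F \<in> borel_measurable (pow_space k)"
        using F by (subst measurable_cong) auto
      have "norm (?F y) \<le> real m + real k" if "y \<in> space (pow_space k)" for y
      proof -
        have "norm (\<Sum>j<m. ?I (y(k := x j))) \<le> (\<Sum>j<m. 1)"
          by (intro sum_norm_le) (auto simp: indicator_def)
        moreover have "norm (\<Sum>i<k. ?I (y(k := y i))) \<le> (\<Sum>i<k. 1)"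
          by (intro sum_norm_le) (auto simp: indicator_def)
        ultimately show ?thesis
          unfolding F[OF that] by (intro order_trans[OF norm_triangle_ineq4]) simp
      qed
      then show "bounded (?F ` space (pow_space k))"
        unfolding bounded_iff by blast
      fix y assume "y \<in> space (pow_space k)" "y \<notin> {..<k} \<rightarrow>\<^sub>E L"
      then have "y(k := z) \<notin> A" for z
        using section_support[OF A(2)] by blast
      then show "?F y = 0"
        by (simp add: point_config_def)
    qed (rule L)
    have "falling_power (point_config m x) (Suc k) A = (\<Sum>\<iota>\<in>injections k m. ?F (select k x \<iota>))"
      using pow_integral_falling_config[OF Suc sb] by simp
    also have "\<dots> = (\<Sum>\<iota>\<in>injections k m. \<Sum>j\<in>{..<m} - \<iota> ` {..<k}. ?I (select (Suc k) x (\<iota>(k := j))))"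
    proof (intro sum.cong refl)
      fix \<iota> assume \<iota>: "\<iota> \<in> injections k m"
      let ?G = "\<lambda>j. ?I (select (Suc k) x (\<iota>(k := j)))"
      have "(\<Sum>i<k. ?I ((select k x \<iota>)(k := select k x \<iota> i))) = (\<Sum>i<k. ?G (\<iota> i))"
      proof (intro sum.cong refl)
        fix i assume "i \<in> {..<k}"
        then have "select k x \<iota> i = x (\<iota> i)"
          by (simp add: select_def)
        then show "?I ((select k x \<iota>)(k := select k x \<iota> i)) = ?G (\<iota> i)"
          by (simp add: select_upd)
      qed
      \<comment> \<open>Injectivity of \<open>\<iota>\<close> ensures that no index is subtracted
        twice.\<close>
      also have "\<dots> = (\<Sum>j\<in>\<iota> ` {..<k}. ?G j)"
        by (simp add: sum.reindex[OF injections_inj[OF \<iota>]])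
      finally have "?F (select k x \<iota>) = (\<Sum>j<m. ?G j) - (\<Sum>j\<in>\<iota> ` {..<k}. ?G j)"
        unfolding F[OF select_space] by (simp add: select_upd)
      also have "\<dots> = (\<Sum>j\<in>{..<m} - \<iota> ` {..<k}. ?G j)"
        using injections_less[OF \<iota>] by (intro sum_diff[symmetric]) auto
      finally show "?F (select k x \<iota>) = \<dots>" .
    qed
    also have "\<dots> = (\<Sum>\<iota>\<in>injections (Suc k) m. ?I (select (Suc k) x \<iota>))"
      by (rule sum_injections_Suc[symmetric])
    finally show "falling_power (point_config m x) (Suc k) A = \<dots>" .
  qed
qed

lemmas pow_integral_falling = pow_integral_falling_config[OF falling_config]

text \<open>Adding a point outside \<open>L\<close> changes the polynomial only through injections that hit this
  point; by induction on \<open>k\<close> only those of full length \<open>k\<close> survive, and by symmetry each of these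
  contributes the same value \<open>g k y\<close>.\<close>

lemma injection_sums_determine_support:
  fixes g :: "nat \<Rightarrow> (nat \<Rightarrow> 'a::polish_space) \<Rightarrow> 'k::{real_normed_field, euclidean_space}"
  assumes sym: "\<And>k. k \<in> {1..n} \<Longrightarrow> g k \<in> sym_funs k"
    and eq: "\<And>r x. x r \<notin> L \<Longrightarrow> (\<Sum>k=1..n. \<Sum>\<iota>\<in>injections k (Suc r). g k (select k x \<iota>))
      = (\<Sum>k=1..n. \<Sum>\<iota>\<in>injections k r. g k (select k x \<iota>))"
    and "k \<in> {1..n}" "y \<in> space (pow_space k)" "y \<notin> {..<k} \<rightarrow>\<^sub>E L"
  shows "g k y = 0"
  using assms(3-5)
proof (induction k arbitrary: y rule: less_induct)
  case (less k)
  obtain r where k: "k = Suc r"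
    using less.prems(1) by (cases k) auto
  obtain i where i: "i < k" "y i \<notin> L"
    using less.prems(2,3) by (auto simp: space_pow_space PiE_iff)
  \<comment> \<open>The swap moves a coordinate outside \<open>L\<close> to the last place
    \<open>r\<close>, so that dropping the last point means dropping a point outside
    \<open>L\<close>. Symmetry keeps the value of \<open>g k\<close>.\<close>
  define x where "x = y \<circ> Transposition.transpose i r"
  have "Transposition.transpose i r permutes {..<k}"
    using i k by (intro permutes_swap_id) auto
  then have gx: "g k x = g k y"
    using sym[OF less.prems(1)] less.prems(2) by (auto simp: x_def sym_funs_def)
  have x: "x \<in> space (pow_space k)"
    using less.prems(2) i k by (auto simp: x_def space_pow_space PiE_iff extensional_def Transposition.transpose_def)
  have xr: "x r \<notin> L"
    using i by (simp add: x_def)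
  \<comment> \<open>\<open>?D j\<close> collects the injections that use the index \<open>r\<close>,
    that is, the change of the degree \<open>j\<close> term caused by the last point.\<close>
  let ?D = "\<lambda>j. \<Sum>\<iota>\<in>injections j k - injections j r. g j (select j x \<iota>)"
  have diff: "?D j = (\<Sum>\<iota>\<in>injections j k. g j (select j x \<iota>)) - (\<Sum>\<iota>\<in>injections j r. g j (select j x \<iota>))" for j
    using k by (intro sum_diff finite_injections injections_mono) simp
  have "(\<Sum>j=1..n. ?D j) = (\<Sum>j=1..n. \<Sum>\<iota>\<in>injections j k. g j (select j x \<iota>))
      - (\<Sum>j=1..n. \<Sum>\<iota>\<in>injections j r. g j (select j x \<iota>))"
    unfolding diff by (rule sum_subtractf)
  then have "(\<Sum>j=1..n. ?D j) = 0"
    using eq[of x r, OF xr] unfolding k by simp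
  also have "(\<Sum>j=1..n. ?D j) = (\<Sum>j=1..n. if j = k then ?D k else 0)"
  proof (intro sum.cong refl)
    fix j assume j: "j \<in> {1..n}"
    show "?D j = (if j = k then ?D k else 0)"
    proof (cases j k rule: linorder_cases)
      case lt: less
      have "g j (select j x \<iota>) = 0" if "\<iota> \<in> injections j k - injections j r" for \<iota>
      proof (rule less.IH[OF lt j select_space])
        have "\<exists>i'<j. \<iota> i' = r"
        proof (rule ccontr)
          assume "\<not> ?thesis"
          then have "\<iota> i' < r" if "i' < j" for i'
            using injections_less[of \<iota> j k i'] \<open>\<iota> \<in> _\<close> that k by (auto simp: less_Suc_eq)
          then show False
            using that by (auto simp: injections_def PiE_iff)
        qed
        then obtain i' where "i' < j" "\<iota> i' = r"
          by blast
        then show "select j x \<iota> \<notin> {..<j} \<rightarrow>\<^sub>E L"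
          using xr by (auto simp: select_def PiE_iff)
      qed
      then show ?thesis
        using lt by simp
    next
      case greater
      then show ?thesis
        by (simp add: injections_empty)
    qed simp
  qed
  also have "\<dots> = ?D k"
    using less.prems(1) by simp
  also have "\<dots> = (\<Sum>\<iota>\<in>injections k k. g k x)"
  proof (intro sum.cong)
    show "injections k k - injections k r = injections k k"
      using k by (simp add: injections_empty)
    fix \<iota> assume \<iota>: "\<iota> \<in> injections k k"
    \<comment> \<open>Extended by the identity, an injection of \<open>{..<k}\<close> into itself is
      a permutation, under which the symmetric \<open>g k\<close> is invariant.\<close>
    define \<pi> where "\<pi> j = (if j < k then \<iota> j else j)" for j
    have "inj_on \<pi> {..<k}"
      using injections_inj[OF \<iota>] by (auto simp: inj_on_def \<pi>_def)
    moreover have "\<pi> ` {..<k} \<subseteq> {..<k}"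
      using injections_less[OF \<iota>] by (auto simp: \<pi>_def)
    ultimately have "bij_betw \<pi> {..<k} {..<k}"
      by (simp add: bij_betw_def endo_inj_surj)
    then have "\<pi> permutes {..<k}"
      by (rule bij_imp_permutes) (simp add: \<pi>_def)
    moreover have "select k x \<iota> = x \<circ> \<pi>"
      using x by (auto simp: fun_eq_iff select_def \<pi>_def space_pow_space PiE_iff extensional_def)
    ultimately show "g k (select k x \<iota>) = g k x"
      using sym[OF less.prems(1)] x by (auto simp: sym_funs_def)
  qed
  also have "\<dots> = of_nat (card (injections k k)) * g k x"
    by simp
  finally have "of_nat (card (injections k k)) * g k x = 0"
    by simp
  \<comment> \<open>The cardinality is \<open>k!\<close>, which is nonzero also as a scalar and can
    be cancelled.\<close>
  moreover have "card (injections k k) \<noteq> 0"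
    using card_injections[of k k] by (intro notI) simp
  ultimately show ?case
    using gx by simp
qed

section \<open>The Poisson functional\<close>

text \<open>Only the coordinates in the image \<open>I\<close> enter \<open>g\<close>. Fubini's
  theorem splits off the remaining \<open>m - k\<close> coordinates, each of which contributes the
  integral of \<open>h\<close>, and \<open>\<iota>\<close> relabels \<open>I\<close> as
  \<open>{..<k}\<close>.\<close>

lemma integral_select:
  fixes g :: "(nat \<Rightarrow> 'a::polish_space) \<Rightarrow> 'k::{real_normed_field, euclidean_space}"
  assumes dens: "density_on \<omega> L P h" and \<iota>: "\<iota> \<in> injections k m"
    and g: "g \<in> borel_measurable (pow_space k)" "bounded (g ` space (pow_space k))"
  shows "(\<integral>x. g (select k x \<iota>) * (\<Prod>i<m. h (x i)) \<partial>pow_prob P m)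
    = (\<integral>x. g x * (\<Prod>i<k. h (x i)) \<partial>pow_prob P k) * (\<integral>y. h y \<partial>P) ^ (m - k)"
proof -
  interpret product_prob_space "\<lambda>_. P"
    using dens by (intro product_prob_space_const) (simp add: density_on_def)
  have h: "integrable P h" and P: "prob_space P"
    using dens by (auto simp: density_on_def)
  define I where "I = \<iota> ` {..<k}"
  define J where "J = {..<m} - I"
  have IJ: "I \<inter> J = {}" "finite I" "finite J" "{..<m} = I \<union> J"
    using injections_less[OF \<iota>] by (auto simp: I_def J_def)
  have cJ: "card J = m - k"
    using IJ injections_less[OF \<iota>] card_image[OF injections_inj[OF \<iota>]]
    unfolding J_def by (subst card_Diff_subset) (auto simp: I_def)
  have int: "integrable (pow_prob P m) (\<lambda>x. g (select k x \<iota>) * (\<Prod>i<m. h (x i)))"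
    using g measurable_compose[OF measurable_select[OF \<iota>] g(1)]
    by (intro integrable_mult_density[OF dens]) (auto intro: bounded_subset simp: select_space)
  have prodI: "(\<Prod>i\<in>I. h (x i)) = (\<Prod>i<k. h (select k x \<iota> i))" for x
    unfolding I_def by (subst prod.reindex[OF injections_inj[OF \<iota>]]) (simp add: select_def)
  have "(\<integral>x. g (select k x \<iota>) * (\<Prod>i<m. h (x i)) \<partial>pow_prob P m)
    = (\<integral>x. \<integral>y. g (select k (merge I J (x, y)) \<iota>) * (\<Prod>i<m. h (merge I J (x, y) i)) \<partial>PiM J (\<lambda>_. P) \<partial>PiM I (\<lambda>_. P))"
    unfolding IJ(4) by (rule product_integral_fold) (use IJ int in auto)
  also have "\<dots> = (\<integral>x. (g (select k x \<iota>) * (\<Prod>i\<in>I. h (x i))) * (\<integral>y. h y \<partial>P) ^ (m - k) \<partial>PiM I (\<lambda>_. P))"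
  proof (intro Bochner_Integration.integral_cong refl)
    fix x :: "nat \<Rightarrow> 'a"
    have "select k (merge I J (x, y)) \<iota> = select k x \<iota>" for y
      by (auto simp: select_def fun_eq_iff restrict_def merge_def I_def)
    moreover have "(\<Prod>i<m. h (merge I J (x, y) i)) = (\<Prod>i\<in>I. h (x i)) * (\<Prod>i\<in>J. h (y i))" for y
      unfolding IJ(4) using IJ
      by (subst prod.union_disjoint) (auto simp: merge_def intro!: arg_cong2[where f="(*)"] prod.cong)
    moreover have "(\<integral>y. (\<Prod>i\<in>J. h (y i)) \<partial>PiM J (\<lambda>_. P)) = (\<integral>y. h y \<partial>P) ^ (m - k)"
      using product_integral_prod[of J "\<lambda>_. h"] IJ h cJ by simp
    ultimately show "(\<integral>y. g (select k (merge I J (x, y)) \<iota>) * (\<Prod>i<m. h (merge I J (x, y) i)) \<partial>PiM J (\<lambda>_. P))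
        = (g (select k x \<iota>) * (\<Prod>i\<in>I. h (x i))) * (\<integral>y. h y \<partial>P) ^ (m - k)"
      by (simp add: mult.assoc[symmetric])
  qed
  also have "\<dots> = (\<integral>x. g (select k x \<iota>) * (\<Prod>i<k. h (select k x \<iota> i)) \<partial>PiM I (\<lambda>_. P)) * (\<integral>y. h y \<partial>P) ^ (m - k)"
    by (simp add: prodI)
  also have "(\<integral>x. g (select k x \<iota>) * (\<Prod>i<k. h (select k x \<iota> i)) \<partial>PiM I (\<lambda>_. P))
      = (\<integral>x. g x * (\<Prod>i<k. h (x i)) \<partial>pow_prob P k)"
  proof -
    \<comment> \<open>All factors are the same measure \<open>P\<close>, so reindexing along the
      injective \<open>\<iota>\<close> carries the product over \<open>I\<close> to the product over
      \<open>{..<k}\<close>.\<close>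
    have "distr (PiM I (\<lambda>_. P)) (pow_prob P k) (\<lambda>x. select k x \<iota>) = pow_prob P k"
      unfolding select_def using distr_PiM_reindex[of I "\<lambda>_. P" \<iota> "{..<k}"] P injections_inj[OF \<iota>]
      by (auto simp: I_def)
    moreover have "(\<lambda>x. select k x \<iota>) \<in> measurable (PiM I (\<lambda>_. P)) (pow_prob P k)"
      unfolding select_def by (intro measurable_restrict measurable_component_singleton) (auto simp: I_def)
    moreover have "(\<lambda>x. g x * (\<Prod>i<k. h (x i))) \<in> borel_measurable (pow_prob P k)"
      using integrable_mult_density[OF dens g] by (rule borel_measurable_integrable)
    ultimately show ?thesis
      using integral_distr[of "\<lambda>x. select k x \<iota>" "PiM I (\<lambda>_. P)" "pow_prob P k" "\<lambda>x. g x * (\<Prod>i<k. h (x i))"]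
      by simp
  qed
  finally show ?thesis .
qed

text \<open>The number of injections reduces \<open>1 / m!\<close> to \<open>1 / (m - k)!\<close>.
  Terms with \<open>m < k\<close> are 0 because no injection exists, so this is the exponential
  series shifted by \<open>k\<close>.\<close>

lemma exp_series_shift:
  fixes c :: "'k::{real_normed_field, euclidean_space}"
  shows "(\<lambda>m. 1 / fact m * (of_nat (card (injections k m)) * (a * c ^ (m - k)))) sums (a * exp c)"
proof -
  have "(\<lambda>m. a * (c ^ m /\<^sub>R fact m)) sums (a * exp c)"
    by (intro sums_mult exp_converges)
  moreover have "1 / fact (m + k) * (of_nat (card (injections k (m + k))) * (a * c ^ (m + k - k)))
      = a * (c ^ m /\<^sub>R fact m)" for m
  proof -
    have "of_nat (card (injections k (m + k))) * (fact m :: 'k) = fact (m + k)"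
      using arg_cong[OF card_injections[of k "m + k"], of "of_nat :: nat \<Rightarrow> 'k"] by simp
    then have "1 / fact (m + k) * of_nat (card (injections k (m + k))) = (1 / fact m :: 'k)"
      by (simp add: field_simps)
    then have "1 / fact (m + k) * (of_nat (card (injections k (m + k))) * (a * c ^ (m + k - k))) = 1 / fact m * (a * c ^ m)"
      by (simp add: mult.assoc[symmetric] del: times_divide_eq_left)
    also have "\<dots> = a * (c ^ m /\<^sub>R fact m)"
      by (simp add: scaleR_conv_of_real field_simps)
    finally show ?thesis .
  qed
  ultimately have "(\<lambda>m. 1 / fact (m + k) * (of_nat (card (injections k (m + k))) * (a * c ^ (m + k - k)))) sums (a * exp c)"
    by simp
  then show ?thesis
    by (subst (asm) sums_zero_iff_shift) (simp_all add: injections_empty)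
qed

section \<open>Windows of a polynomial\<close>

lemma supported_bounded_sym_funs_window:
  assumes "g \<in> sym_funs k" "L \<in> relcompact_borel"
    and "\<And>x. x \<in> space (pow_space k) \<Longrightarrow> x \<notin> {..<k} \<rightarrow>\<^sub>E L \<Longrightarrow> g x = 0"
  shows "supported_bounded k L g"
  using assms by (auto simp: supported_bounded_def sym_funs_def intro: bounded_subset)

text \<open>Makes the \<open>SOME\<close> in \<open>poisson_functional\<close> meaningful:
  \<open>p\<close> has the coefficient \<open>f\<close> in degree \<open>n\<close> and 0 in all
  others, and a window of \<open>f\<close> serves.\<close>

lemma poisson_window_exists:
  assumes f: "f \<in> sym_funs n"
    and p: "\<And>\<nu>. \<nu> \<in> radon_measures \<Longrightarrow> p \<nu> = pow_integral n (tensor_power \<nu> n) f"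
  shows "\<exists>L. poisson_window p L"
proof -
  obtain L where L: "supported_bounded n L f" "\<And>x. x \<notin> {..<n} \<rightarrow>\<^sub>E L \<Longrightarrow> f x = 0"
    using supported_bounded_sym_funs[OF f] by blast
  let ?g = "\<lambda>k. if k = n then f else (\<lambda>_. 0)"
  have zero: "(\<lambda>_. 0) \<in> sym_funs k" for k
    by (auto simp: sym_funs_def intro!: exI[of _ "{}"])
  have "p \<nu> = (\<Sum>k\<le>n. pow_integral k (tensor_power \<nu> k) (?g k))" if \<nu>: "\<nu> \<in> radon_measures" for \<nu>
  proof -
    \<comment> \<open>The zero function is supported in the empty window, so a density on
      \<open>{}\<close> is enough to integrate it in every degree.\<close>
    obtain P h where dens: "density_on \<nu> {} P h"
      using density_on_exists[OF \<nu> empty_relcompact_borel] by blast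
    have "pow_integral k (tensor_power \<nu> k) (\<lambda>_. 0) = 0" for k
      using pow_integral_tensor[OF \<nu> _ dens, of k "\<lambda>_. 0"]
      by (simp add: supported_bounded_def empty_relcompact_borel image_constant_conv)
    then have "(\<Sum>k\<le>n. pow_integral k (tensor_power \<nu> k) (?g k))
        = (\<Sum>k\<le>n. if k = n then pow_integral n (tensor_power \<nu> n) f else 0)"
      by (intro sum.cong refl) auto
    then show ?thesis
      using p[OF \<nu>] by simp
  qed
  then have "poly_coeffs n ?g p"
    using f zero by (auto simp: poly_coeffs_def)
  moreover have "\<forall>k\<in>{1..n}. \<forall>x. x \<notin> ({..<k} \<rightarrow>\<^sub>E L) \<longrightarrow> ?g k x = 0"
    using L(2) by auto
  ultimately have "poisson_window p L"
    using L(1) by (auto simp: poisson_window_def supported_bounded_def)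
  then show ?thesis ..
qed

text \<open>The coefficients are supported in powers of \<open>L\<close>, so \<open>p\<close> is
  computed from a density on \<open>L\<close>, and one pair \<open>P\<close>, \<open>h\<close> is a
  density of both measures.\<close>

lemma poisson_window_local:
  assumes W: "poisson_window p L" and \<nu>: "\<nu> \<in> radon_measures" "\<nu>' \<in> radon_measures"
    and eq: "\<And>A. A \<in> sets borel \<Longrightarrow> A \<subseteq> L \<Longrightarrow> \<nu> A = \<nu>' A"
  shows "p \<nu> = p \<nu>'"
proof -
  obtain N g where L: "L \<in> relcompact_borel" and g: "poly_coeffs N g p"
    and supp: "\<And>k x. k \<in> {1..N} \<Longrightarrow> x \<notin> ({..<k} \<rightarrow>\<^sub>E L) \<Longrightarrow> g k x = 0"
    using W unfolding poisson_window_def by blast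
  obtain P h where dens: "density_on \<nu> L P h"
    using density_on_exists[OF \<nu>(1) L] by blast
  then have dens': "density_on \<nu>' L P h"
    using eq by (auto simp: density_on_def)
  have "supported_bounded k L (g k)" if "k \<le> N" for k
  proof (rule supported_bounded_sym_funs_window[OF _ L])
    show "g k \<in> sym_funs k"
      using g that by (simp add: poly_coeffs_def)
    fix x :: "nat \<Rightarrow> 'a" assume x: "x \<in> space (pow_space k)" "x \<notin> {..<k} \<rightarrow>\<^sub>E L"
    \<comment> \<open>In degree 0 the power of \<open>L\<close> is the whole one-point space, so no
      point lies outside it; the support condition of a window starts at degree 1.\<close>
    then have "k \<noteq> 0"
      by (intro notI) (simp add: space_pow_space)
    then show "g k x = 0"
      using supp x that by auto
  qed
  then show ?thesis
    using g \<nu> pow_integral_tensor[OF \<nu>(1) _ dens] pow_integral_tensor[OF \<nu>(2) _ dens']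
    by (simp add: poly_coeffs_def)
qed

lemma point_config_Suc_outside:
  assumes "x r \<notin> L" "A \<subseteq> L"
  shows "point_config (Suc r) x A = point_config r x A"
  using assms by (auto simp: point_config_def indicator_def)

text \<open>Only the values of \<open>p\<close> on configurations enter the functional. Each
  injection contributes \<open>a k * c ^ (m - k)\<close>, and the prefactor \<open>exp (- c)\<close>
  cancels the exponential series.\<close>

lemma poisson_on_sum:
  fixes g :: "nat \<Rightarrow> (nat \<Rightarrow> 'a::polish_space) \<Rightarrow> 'k::{real_normed_field, euclidean_space}"
  assumes \<omega>: "\<omega> \<in> radon_measures" and g: "\<And>k. k \<in> {1..n} \<Longrightarrow> supported_bounded k L (g k)"
    and L: "L \<in> relcompact_borel"
    and p: "\<And>m x. p (point_config m x) = (\<Sum>k=1..n. \<Sum>\<iota>\<in>injections k m. g k (select k x \<iota>))"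
  shows "poisson_on L \<omega> p = (\<Sum>k=1..n. pow_integral k (tensor_power \<omega> k) (g k))"
proof -
  obtain P h where dens: "density_on \<omega> L P h" and h0: "\<And>x. x \<notin> L \<Longrightarrow> h x = 0"
    using density_on_exists[OF \<omega> L] by metis
  have L': "L \<in> sets borel"
    using L by (rule relcompact_borel_borel)
  \<comment> \<open>This is \<open>\<omega> L\<close>, written as an integral over the whole space
    because \<open>h\<close> vanishes outside \<open>L\<close>.\<close>
  define c where "c = (\<integral>y. h y \<partial>P)"
  have "\<omega> L = (\<integral>y. indicator L y * h y \<partial>P)"
    using dens L' by (simp add: density_on_def)
  also have "\<dots> = c"
    unfolding c_def using h0 by (intro Bochner_Integration.integral_cong refl) (auto simp: indicator_def)
  finally have \<omega>L: "\<omega> L = c" .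
  define a where "a k = (\<integral>x. g k x * (\<Prod>i<k. h (x i)) \<partial>pow_prob P k)" for k
  have a: "pow_integral k (tensor_power \<omega> k) (g k) = a k" if "k \<in> {1..n}" for k
    unfolding a_def using pow_integral_tensor[OF \<omega> g[OF that] dens] .
  have gm: "g k \<in> borel_measurable (pow_space k)" "bounded (g k ` space (pow_space k))" if "k \<in> {1..n}" for k
    using g[OF that] by (auto simp: supported_bounded_def)
  have term_m: "pow_integral m (tensor_power \<omega> m) (\<lambda>x. indicator ({..<m} \<rightarrow>\<^sub>E L) x * p (point_config m x))
      = (\<Sum>k=1..n. of_nat (card (injections k m)) * (a k * c ^ (m - k)))" for m
  proof -
    let ?L = "{..<m} \<rightarrow>\<^sub>E L" and ?H = "\<lambda>x. \<Prod>i<m. h (x i)"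
    let ?q = "\<lambda>x. \<Sum>k=1..n. \<Sum>\<iota>\<in>injections k m. g k (select k x \<iota>)"
    have sel: "(\<lambda>x. g k (select k x \<iota>)) \<in> borel_measurable (pow_space m)"
      "bounded ((\<lambda>x. g k (select k x \<iota>)) ` space (pow_space m))" if "k \<in> {1..n}" "\<iota> \<in> injections k m" for k \<iota>
      using measurable_compose[OF measurable_select[OF that(2)] gm(1)[OF that(1)]] gm(2)[OF that(1)]
      by (auto intro: bounded_subset simp: select_space)
    have bsum: "bounded ((\<lambda>x. \<Sum>i\<in>I. F i x) ` X)" if "\<And>i. i \<in> I \<Longrightarrow> bounded (F i ` X)" "finite I"
      for I :: "'i set" and F :: "'i \<Rightarrow> 'x \<Rightarrow> 'k" and X
      using that(2,1) by (induction I) (auto intro: bounded_plus_comp simp: image_constant_conv)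
    have q: "?q \<in> borel_measurable (pow_space m)" "bounded (?q ` space (pow_space m))"
      using sel by (auto intro!: borel_measurable_sum bsum finite_injections)
    have "supported_bounded m L (\<lambda>x. indicator ?L x * ?q x)"
      unfolding supported_bounded_def
    proof (intro conjI ballI impI)
      show "(\<lambda>x. indicator ?L x * ?q x) \<in> borel_measurable (pow_space m)"
        using PiE_sets_pow_space[OF L'] q(1) by (intro borel_measurable_times borel_measurable_indicator)
      obtain B where "\<And>x. x \<in> space (pow_space m) \<Longrightarrow> norm (?q x) \<le> B"
        using q(2) by (auto simp: bounded_iff)
      then have "norm (indicator ?L x * ?q x) \<le> \<bar>B\<bar>" if "x \<in> space (pow_space m)" for x
        using that by (auto simp: indicator_def intro: order_trans[OF _ abs_ge_self])
      then show "bounded ((\<lambda>x. indicator ?L x * ?q x) ` space (pow_space m))"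
        unfolding bounded_iff by blast
    qed (use L in auto)
    then have "pow_integral m (tensor_power \<omega> m) (\<lambda>x. indicator ?L x * p (point_config m x))
        = (\<integral>x. indicator ?L x * ?q x * ?H x \<partial>pow_prob P m)"
      unfolding p by (rule pow_integral_tensor[OF \<omega> _ dens])
    also have "\<dots> = (\<integral>x. (\<Sum>k=1..n. \<Sum>\<iota>\<in>injections k m. g k (select k x \<iota>) * ?H x) \<partial>pow_prob P m)"
    proof (intro Bochner_Integration.integral_cong refl)
      fix x assume "x \<in> space (pow_prob P m)"
      then have x: "x \<in> space (pow_space m)"
        by (simp add: space_pow_prob[OF dens])
      have absorb: "indicator ?L x * ?H x = ?H x"
      proof (cases "x \<in> ?L")
        case False
        then obtain i where "i < m" "x i \<notin> L"
          using x by (auto simp: space_pow_space PiE_iff)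
        then have "?H x = 0"
          using h0 by (intro prod_zero) auto
        then show ?thesis by simp
      qed simp
      have "indicator ?L x * ?q x * ?H x = ?q x * (indicator ?L x * ?H x)"
        by (simp only: mult_ac)
      also have "\<dots> = ?q x * ?H x"
        by (simp only: absorb)
      finally show "indicator ?L x * ?q x * ?H x = (\<Sum>k=1..n. \<Sum>\<iota>\<in>injections k m. g k (select k x \<iota>) * ?H x)"
        by (simp add: sum_distrib_right)
    qed
    also have "\<dots> = (\<Sum>k=1..n. \<integral>x. (\<Sum>\<iota>\<in>injections k m. g k (select k x \<iota>) * ?H x) \<partial>pow_prob P m)"
      using sel by (intro Bochner_Integration.integral_sum Bochner_Integration.integrable_sum integrable_mult_density[OF dens])
    also have "\<dots> = (\<Sum>k=1..n. \<Sum>\<iota>\<in>injections k m. \<integral>x. g k (select k x \<iota>) * ?H x \<partial>pow_prob P m)"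
      using sel by (intro sum.cong refl Bochner_Integration.integral_sum integrable_mult_density[OF dens])
    also have "\<dots> = (\<Sum>k=1..n. \<Sum>\<iota>\<in>injections k m. a k * c ^ (m - k))"
      using gm by (intro sum.cong refl) (simp add: integral_select[OF dens] a_def c_def)
    finally show ?thesis by simp
  qed
  \<comment> \<open>The sum over \<open>k\<close> is finite, so the series in \<open>m\<close> is
    summed degree by degree.\<close>
  have "(\<lambda>m. \<Sum>k=1..n. 1 / fact m * (of_nat (card (injections k m)) * (a k * c ^ (m - k)))) sums (\<Sum>k=1..n. a k * exp c)"
    by (intro sums_sum exp_series_shift)
  then have "(\<Sum>m. 1 / fact m * pow_integral m (tensor_power \<omega> m) (\<lambda>x. indicator ({..<m} \<rightarrow>\<^sub>E L) x * p (point_config m x)))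
      = (\<Sum>k=1..n. a k * exp c)"
    unfolding term_m sum_distrib_left by (rule sums_unique[symmetric])
  then have "poisson_on L \<omega> p = exp (- c) * (\<Sum>k=1..n. a k * exp c)"
    by (simp only: poisson_on_def \<omega>L)
  also have "\<dots> = (exp (- c) * exp c) * (\<Sum>k=1..n. a k)"
    by (simp only: sum_distrib_left[symmetric] mult_ac)
  also have "\<dots> = (\<Sum>k=1..n. a k)"
    by (simp add: exp_minus_inverse mult.commute[of "exp (- c)"])
  finally show ?thesis
    using a by simp
qed

theorem theorem6p1:
  fixes n :: nat
    and f :: "(nat \<Rightarrow> 'a::polish_space) \<Rightarrow> 'k::{real_normed_field, euclidean_space}"
    and S :: "nat \<Rightarrow> nat \<Rightarrow> ((nat \<Rightarrow> 'a) \<Rightarrow> 'k) \<Rightarrow> (nat \<Rightarrow> 'a) \<Rightarrow> 'k"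
    and p :: "('a set \<Rightarrow> 'k) \<Rightarrow> 'k"
    and \<omega> :: "'a set \<Rightarrow> 'k"
  assumes "locally_compact_space (euclidean :: 'a topology)"
    and "n \<ge> 1"
    and "f \<in> sym_funs n"
    and "stirling_operators n S"
    and "\<And>\<nu>. \<nu> \<in> radon_measures \<Longrightarrow> p \<nu> = pow_integral n (tensor_power \<nu> n) f"
    and "\<omega> \<in> radon_measures"
  shows "poisson_functional \<omega> p = (\<Sum>k=1..n. pow_integral k (tensor_power \<omega> k) (S n k f))"
proof -
  \<comment> \<open>The window comes from an unspecified representation of \<open>p\<close>, so only
    \<open>poisson_window p L\<close> is known about it.\<close>
  define L where "L = (SOME L. poisson_window p L)"
  have W: "poisson_window p L"
    unfolding L_def using poisson_window_exists[OF assms(3,5)] by (rule someI_ex)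
  then have L: "L \<in> relcompact_borel"
    by (simp add: poisson_window_def)
  have sym: "S n k f \<in> sym_funs k" if "k \<in> {1..n}" for k
    using assms(3,4) that by (auto simp: stirling_operators_def)
  \<comment> \<open>Configurations are Radon measures, so the defining identity of the Stirling
    operators applies to them, and the falling powers become sums over injections.\<close>
  have pc: "p (point_config m x) = (\<Sum>k=1..n. \<Sum>\<iota>\<in>injections k m. S n k f (select k x \<iota>))" for m x
  proof -
    have "p (point_config m x) = (\<Sum>k=1..n. pow_integral k (falling_power (point_config m x) k) (S n k f))"
      using assms(3-5) point_config_radon[of m x] by (auto simp: stirling_operators_def)
    also have "\<dots> = (\<Sum>k=1..n. \<Sum>\<iota>\<in>injections k m. S n k f (select k x \<iota>))"
    proof (intro sum.cong refl)
      fix k assume "k \<in> {1..n}"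
      then obtain L' where "supported_bounded k L' (S n k f)"
        using supported_bounded_sym_funs[OF sym] by metis
      then show "pow_integral k (falling_power (point_config m x) k) (S n k f)
          = (\<Sum>\<iota>\<in>injections k m. S n k f (select k x \<iota>))"
        by (rule pow_integral_falling)
    qed
    finally show ?thesis .
  qed
  \<comment> \<open>The window contains the supports of the coefficients of \<open>p\<close> in one
    representation; locality of \<open>p\<close> transfers this to the
    \<open>S n k f\<close>.\<close>
  have "supported_bounded k L (S n k f)" if k: "k \<in> {1..n}" for k
  proof (rule supported_bounded_sym_funs_window[OF sym[OF k] L])
    fix y :: "nat \<Rightarrow> 'a" assume y: "y \<in> space (pow_space k)" "y \<notin> {..<k} \<rightarrow>\<^sub>E L"
    show "S n k f y = 0"
    proof (rule injection_sums_determine_support[where g = "\<lambda>k. S n k f", OF sym _ k y])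
      fix r and x :: "nat \<Rightarrow> 'a" assume "x r \<notin> L"
      \<comment> \<open>The additional point lies outside \<open>L\<close>, so both configurations
        have the same trace on \<open>L\<close>.\<close>
      then have "p (point_config (Suc r) x) = p (point_config r x)"
        by (intro poisson_window_local[OF W] point_config_radon point_config_Suc_outside)
      then show "(\<Sum>k=1..n. \<Sum>\<iota>\<in>injections k (Suc r). S n k f (select k x \<iota>))
          = (\<Sum>k=1..n. \<Sum>\<iota>\<in>injections k r. S n k f (select k x \<iota>))"
        unfolding pc .
    qed
  qed
  then show ?thesis
    unfolding poisson_functional_def L_def[symmetric]
    by (intro poisson_on_sum[OF assms(6) _ L pc])
qed

end
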